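(* Let $R$ be an integral domain with quotient field $K$, $R\neq K$. The following conditions are equivalent: (1) $R$ is an integrally closed $w$-divisorial domain; (2) $R$ is a weakly Matlis $PvMD$ and each $t$-maximal ideal of $R$ is $t$-invertible.
   Context: For fractional ideals $I,J$ of $R$ put $(J:I)=\{x\in K: xI\subseteq J\}$. For a nonzero fractional ideal $I$: $I_v=(R:(R:I))$; $I_t=\bigcup J_v$, the union over nonzero finitely generated fractional ideals $J\subseteq I$. $I$ is divisorial if $I=I_v$, a $t$-ideal if $I=I_t$, and $t$-invertible if $(I(R:I))_t=R$. A $t$-prime is a nonzero prime ideal that is a $t$-ideal; a $t$-maximal ideal is an ideal maximal among the proper integral $t$-ideals (it is prime); $t\text{-Max}(R)$ is the set of these. $I_w=\bigcap_{M\in t\text{-Max}(R)}IR_M$, and $I$ is a $w$-ideal if $I=I_w$. $R$ is $w$-divisorial if every $w$-ideal is divisorial. $R$ is a weakly Matlis domain if each nonzero element belongs to at most finitely many $t$-maximal ideals and each $t$-prime ideal is contained in a unique $t$-maximal ideal. $R$ is a $PvMD$ (Prüfer $v$-multiplication domain) if $R_M$ is a valuation domain for each $t$-maximal ideal $M$. *)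

theory Defs
  imports "HOL-Algebra.Algebraic_Closure_Type"
begin

text \<open>
  A domain \<open>R\<close> is a subring of a field, which is given as a type \<open>'k\<close>; the assumption
  \<open>has_quotient_field\<close> says that the whole type is the quotient field \<open>K\<close> of \<open>R\<close>. Ideals and
  fractional ideals of \<open>R\<close> and its localizations are subsets of \<open>'k\<close>. All definitions below are
  meant for such \<open>R\<close>.
\<close>

abbreviation ring_on :: "'k::field set \<Rightarrow> 'k ring" where
  "ring_on R \<equiv> ring_of_type_algebra\<lparr>carrier := R\<rparr>"

definition has_quotient_field :: "'k::field set \<Rightarrow> bool" where
  "has_quotient_field R \<longleftrightarrow> (\<forall>x. \<exists>a\<in>R. \<exists>b\<in>R. b \<noteq> 0 \<and> x = a / b)"

definition integrally_closed :: "'k::field set \<Rightarrow> bool" where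
  "integrally_closed R \<longleftrightarrow>
     (\<forall>x p. lead_coeff p = 1 \<and> (\<forall>i. poly.coeff p i \<in> R) \<and> poly p x = 0 \<longrightarrow> x \<in> R)"

definition valuation_domain :: "'k::field set \<Rightarrow> bool" where
  "valuation_domain V \<longleftrightarrow>
     subring V ring_of_type_algebra \<and> (\<forall>x. x \<noteq> 0 \<longrightarrow> x \<in> V \<or> inverse x \<in> V)"

subsection \<open>Fractional ideals\<close>

text \<open>Closure under negation follows from \<open>-1 \<in> R\<close>.\<close>

definition is_submodule :: "'k::field set \<Rightarrow> 'k set \<Rightarrow> bool" where
  "is_submodule R I \<longleftrightarrow>
     0 \<in> I \<and> (\<forall>x\<in>I. \<forall>y\<in>I. x + y \<in> I) \<and> (\<forall>r\<in>R. \<forall>x\<in>I. r * x \<in> I)"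

definition fractional_ideal :: "'k::field set \<Rightarrow> 'k set \<Rightarrow> bool" where
  "fractional_ideal R I \<longleftrightarrow> is_submodule R I \<and> (\<exists>d\<in>R. d \<noteq> 0 \<and> (\<forall>x\<in>I. d * x \<in> R))"

definition nonzero_fractional_ideal :: "'k::field set \<Rightarrow> 'k set \<Rightarrow> bool" where
  "nonzero_fractional_ideal R I \<longleftrightarrow> fractional_ideal R I \<and> I \<noteq> {0}"

definition fin_generated :: "'k::field set \<Rightarrow> 'k set \<Rightarrow> bool" where
  "fin_generated R I \<longleftrightarrow> (\<exists>S. finite S \<and> I = is_submodule R hull S)"

definition colon :: "'k::field set \<Rightarrow> 'k set \<Rightarrow> 'k set" where
  "colon J I = {x. \<forall>y\<in>I. x * y \<in> J}"

definition ideal_mult :: "'k::field set \<Rightarrow> 'k set \<Rightarrow> 'k set \<Rightarrow> 'k set" where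
  "ideal_mult R I J = is_submodule R hull {x * y | x y. x \<in> I \<and> y \<in> J}"

definition localization :: "'k::field set \<Rightarrow> 'k set \<Rightarrow> 'k set" where
  "localization R M = {a / s | a s. a \<in> R \<and> s \<in> R - M}"

subsection \<open>The \<open>v\<close>-, \<open>t\<close>- and \<open>w\<close>-operations\<close>

definition v_closure :: "'k::field set \<Rightarrow> 'k set \<Rightarrow> 'k set" where
  "v_closure R I = colon R (colon R I)"

definition t_closure :: "'k::field set \<Rightarrow> 'k set \<Rightarrow> 'k set" where
  "t_closure R I =
     \<Union>{v_closure R J | J. nonzero_fractional_ideal R J \<and> fin_generated R J \<and> J \<subseteq> I}"

definition divisorial :: "'k::field set \<Rightarrow> 'k set \<Rightarrow> bool" where
  "divisorial R I \<longleftrightarrow> nonzero_fractional_ideal R I \<and> v_closure R I = I"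

definition t_ideal :: "'k::field set \<Rightarrow> 'k set \<Rightarrow> bool" where
  "t_ideal R I \<longleftrightarrow> nonzero_fractional_ideal R I \<and> t_closure R I = I"

definition t_invertible :: "'k::field set \<Rightarrow> 'k set \<Rightarrow> bool" where
  "t_invertible R I \<longleftrightarrow>
     nonzero_fractional_ideal R I \<and> t_closure R (ideal_mult R I (colon R I)) = R"

definition t_prime :: "'k::field set \<Rightarrow> 'k set \<Rightarrow> bool" where
  "t_prime R P \<longleftrightarrow> primeideal P (ring_on R) \<and> t_ideal R P"

definition t_Max :: "'k::field set \<Rightarrow> 'k set set" where
  "t_Max R = {M. t_ideal R M \<and> M \<subset> R \<and> (\<forall>J. t_ideal R J \<and> J \<subset> R \<and> M \<subseteq> J \<longrightarrow> J = M)}"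

definition w_closure :: "'k::field set \<Rightarrow> 'k set \<Rightarrow> 'k set" where
  "w_closure R I = (\<Inter>M\<in>t_Max R. ideal_mult R I (localization R M))"

definition w_ideal :: "'k::field set \<Rightarrow> 'k set \<Rightarrow> bool" where
  "w_ideal R I \<longleftrightarrow> nonzero_fractional_ideal R I \<and> w_closure R I = I"

subsection \<open>Classes of domains\<close>

definition w_divisorial_domain :: "'k::field set \<Rightarrow> bool" where
  "w_divisorial_domain R \<longleftrightarrow> (\<forall>I. w_ideal R I \<longrightarrow> divisorial R I)"

definition weakly_Matlis :: "'k::field set \<Rightarrow> bool" where
  "weakly_Matlis R \<longleftrightarrow>
     (\<forall>x\<in>R. x \<noteq> 0 \<longrightarrow> finite {M \<in> t_Max R. x \<in> M}) \<and>
     (\<forall>P. t_prime R P \<longrightarrow> (\<exists>!M. M \<in> t_Max R \<and> P \<subseteq> M))"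

definition PvMD :: "'k::field set \<Rightarrow> bool" where
  "PvMD R \<longleftrightarrow> (\<forall>M\<in>t_Max R. valuation_domain (localization R M))"

end

theory Submission
  imports Defs
begin

text \<open>
  The domain \<open>R\<close> is \<open>w\<close>-divisorial iff \<open>I\<^sub>v \<subseteq> I\<^sub>w\<close> for all \<open>I\<close>, and membership in \<open>I\<^sub>w\<close> is tested
  locally at each \<open>t\<close>-maximal ideal.

  Let \<open>R\<close> be integrally closed and \<open>w\<close>-divisorial. Since \<open>u \<in> (R + u\<^sup>2 R)\<^sub>v\<close>, locally
  \<open>u \<in> R\<^sub>M + u\<^sup>2 R\<^sub>M\<close>, which makes \<open>R\<^sub>M\<close> a valuation domain. If \<open>M (R : M) \<subseteq> M\<close>, an
  \<open>x \<in> (R : M) - R\<close> would be integral. That a \<open>t\<close>-prime lies in only one \<open>t\<close>-maximal ideal and that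
  \<open>x\<close> lies in only finitely many both come from the divisoriality of the ideals \<open>x R\<^sub>M \<inter> R\<close>.

  Conversely, finite character and the independence of the valuation rings \<open>R\<^sub>M\<close> give
  \<open>(R\<^sub>M : I) = (R : I) R\<^sub>M\<close>, and in a valuation domain with principal maximal ideal every ideal is
  divisorial.
\<close>

text \<open>A statement about \<open>R_M\<close> is rewritten as the existence of some
  \<open>s\<close> in \<open>R - M\<close> that clears denominators, so the arguments become
  identities in \<open>K\<close>. In the same way \<open>t\<close>-invertibility of \<open>M\<close>
  becomes a pair \<open>m\<close> in \<open>M\<close>, \<open>y\<close> in \<open>(R : M)\<close>
  with \<open>m * y\<close> outside \<open>M\<close>: locally \<open>m\<close> generates
  \<open>M\<close> and \<open>y\<close> generates its inverse. The obstacle is that the uniqueness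
  clause of the weakly Matlis property speaks of \<open>t\<close>-primes, while what is needed is
  independence of \<open>R_M\<close> and \<open>R_N\<close>. If independence fails, the non-units of
  the composite ring \<open>R_M R_N\<close> give a nonzero prime of \<open>R\<close> inside both
  \<open>M\<close> and \<open>N\<close>, and over a \<open>PvMD\<close> such a prime is
  automatically a \<open>t\<close>-prime. Uniqueness must therefore be available before finite
  character is proved, since the latter separates \<open>t\<close>-maximal ideals by independence.
  Finiteness itself can be extracted because \<open>w\<close>-divisoriality identifies the
  \<open>v\<close>-closure with the finitary \<open>t\<close>-closure.\<close>

lemma ring_of_type_algebra_simps:
  "carrier ring_of_type_algebra = (UNIV :: 'k::field set)"
  "monoid.mult (ring_of_type_algebra :: 'k ring) = (*)" "add (ring_of_type_algebra :: 'k ring) = (+)"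
  "one (ring_of_type_algebra :: 'k ring) = 1" "zero (ring_of_type_algebra :: 'k ring) = 0"
  by (auto simp: ring_of_type_algebra_def fun_eq_iff)

lemma a_inv_ring_of_type_algebra:
  "\<ominus>\<^bsub>ring_of_type_algebra\<^esub> a = - (a :: 'k::field)"
  by (rule abelian_group.minus_equality[OF ring.is_abelian_group[OF ring_from_type_algebra]])
    (simp_all add: ring_of_type_algebra_simps)

text \<open>The elementary form of \<open>primeideal P (ring_on R)\<close>, free of record
  operations; \<open>primeideal_iff\<close> identifies the two.\<close>

definition prime_of :: "'k::field set \<Rightarrow> 'k set \<Rightarrow> bool" where
  "prime_of R P \<longleftrightarrow> is_submodule R P \<and> P \<subseteq> R \<and> 1 \<notin> P \<and>
     (\<forall>a\<in>R. \<forall>b\<in>R. a * b \<in> P \<longrightarrow> a \<in> P \<or> b \<in> P)"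

locale domain_in_field =
  fixes R :: "'k::field set"
  assumes zero_R [simp]: "0 \<in> R" and one_R [simp]: "1 \<in> R"
    and add_R [intro]: "x \<in> R \<Longrightarrow> y \<in> R \<Longrightarrow> x + y \<in> R"
    and mult_R [intro]: "x \<in> R \<Longrightarrow> y \<in> R \<Longrightarrow> x * y \<in> R"
    and uminus_R [intro]: "x \<in> R \<Longrightarrow> - x \<in> R"
    and quotient: "\<exists>a\<in>R. \<exists>b\<in>R. b \<noteq> 0 \<and> x = a / b"
begin

section \<open>Submodules of the quotient field and fractional ideals\<close>

lemma diff_R [intro]: "x \<in> R \<Longrightarrow> y \<in> R \<Longrightarrow> x - y \<in> R"
  using add_R[of x "- y"] by auto

lemma denominator: "\<exists>b\<in>R. b \<noteq> 0 \<and> b * x \<in> R"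
  using quotient[of x] by force

lemma submodule_zero: "is_submodule R I \<Longrightarrow> 0 \<in> I"
  and submodule_add: "is_submodule R I \<Longrightarrow> x \<in> I \<Longrightarrow> y \<in> I \<Longrightarrow> x + y \<in> I"
  and submodule_mult: "is_submodule R I \<Longrightarrow> r \<in> R \<Longrightarrow> x \<in> I \<Longrightarrow> r * x \<in> I"
  and submodule_mult': "is_submodule R I \<Longrightarrow> x \<in> I \<Longrightarrow> r \<in> R \<Longrightarrow> x * r \<in> I"
  by (auto simp: is_submodule_def mult.commute)

lemma submodule_uminus: "is_submodule R I \<Longrightarrow> x \<in> I \<Longrightarrow> - x \<in> I"
  using submodule_mult[of I "-1" x] uminus_R[OF one_R] by auto

lemma submodule_R: "is_submodule R R"
  by (auto simp: is_submodule_def)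

lemma submodule_hull: "is_submodule R (is_submodule R hull S)"
  by (rule hull_in) (auto simp: is_submodule_def)

lemma nzf_iff:
  "nonzero_fractional_ideal R I \<longleftrightarrow>
     is_submodule R I \<and> (\<exists>d\<in>R. d \<noteq> 0 \<and> (\<forall>x\<in>I. d * x \<in> R)) \<and> (\<exists>x\<in>I. x \<noteq> 0)"
  unfolding nonzero_fractional_ideal_def fractional_ideal_def
  by (auto simp: is_submodule_def)

lemma nzf_submodule: "nonzero_fractional_ideal R I \<Longrightarrow> is_submodule R I"
  by (simp add: nzf_iff)

lemma nzf_integral:
  assumes "is_submodule R I" "I \<subseteq> R" "x \<in> I" "x \<noteq> 0"
  shows "nonzero_fractional_ideal R I"
  unfolding nzf_iff using assms one_R by (metis mult_1 subsetD zero_neq_one)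

lemma nzf_between:
  assumes "nonzero_fractional_ideal R I" "is_submodule R J" "I \<subseteq> J"
    and "d \<in> R" "d \<noteq> 0" "\<forall>x\<in>J. d * x \<in> R"
  shows "nonzero_fractional_ideal R J"
  using assms unfolding nzf_iff by blast

lemma nzf_mem_R:
  assumes "nonzero_fractional_ideal R I"
  obtains a where "a \<in> I" "a \<in> R" "a \<noteq> 0"
proof -
  obtain x where x: "x \<in> I" "x \<noteq> 0" using assms by (auto simp: nzf_iff)
  obtain b where b: "b \<in> R" "b \<noteq> 0" "b * x \<in> R" using denominator by blast
  show ?thesis
    using that[of "b * x"] x b assms submodule_mult by (auto simp: nzf_iff)
qed

text \<open>Used with \<open>I = M\<close> for the primality of \<open>t\<close>-maximal ideals, and
  with \<open>I = R\<close> where quadratic integral equations are produced.\<close>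

definition adjoin :: "'k set \<Rightarrow> 'k \<Rightarrow> 'k set" where
  "adjoin I x = {a + b * x |a b. a \<in> I \<and> b \<in> R}"

lemma adjoinI: "a \<in> I \<Longrightarrow> b \<in> R \<Longrightarrow> a + b * x \<in> adjoin I x"
  unfolding adjoin_def by blast

lemma adjoinE:
  assumes "y \<in> adjoin I x"
  obtains a b where "a \<in> I" "b \<in> R" "y = a + b * x"
  using assms unfolding adjoin_def by blast

lemma adjoin_submodule:
  assumes I: "is_submodule R I"
  shows "is_submodule R (adjoin I x)"
  unfolding is_submodule_def
proof (intro conjI ballI)
  show "0 \<in> adjoin I x" using adjoinI[of 0 I 0] submodule_zero[OF I] by simp
next
  fix y z assume "y \<in> adjoin I x" "z \<in> adjoin I x"
  then obtain a b c d where *: "a \<in> I" "b \<in> R" "c \<in> I" "d \<in> R"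
    and "y = a + b * x" "z = c + d * x"
    by (elim adjoinE)
  then have "y + z = (a + c) + (b + d) * x" by (simp add: algebra_simps)
  then show "y + z \<in> adjoin I x"
    using adjoinI[OF submodule_add[OF I *(1,3)] add_R[OF *(2,4)]] by simp
next
  fix r y assume r: "r \<in> R" and "y \<in> adjoin I x"
  then obtain a b where *: "a \<in> I" "b \<in> R" and "y = a + b * x"
    by (elim adjoinE)
  then have "r * y = r * a + (r * b) * x" by (simp add: algebra_simps)
  then show "r * y \<in> adjoin I x"
    using adjoinI[OF submodule_mult[OF I r *(1)] mult_R[OF r *(2)]] by simp
qed

lemma adjoin_R_nzf: "nonzero_fractional_ideal R (adjoin R x)"
proof -
  obtain d where d: "d \<in> R" "d \<noteq> 0" "d * x \<in> R" using denominator by blast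
  have "\<forall>y\<in>adjoin R x. d * y \<in> R"
  proof
    fix y assume "y \<in> adjoin R x"
    then obtain a b where "a \<in> R" "b \<in> R" "y = a + b * x" by (rule adjoinE)
    then have "d * y = d * a + b * (d * x)" by (simp add: algebra_simps)
    then show "d * y \<in> R" using d \<open>a \<in> R\<close> \<open>b \<in> R\<close> add_R mult_R by simp
  qed
  moreover have "1 \<in> adjoin R x" using adjoinI[of 1 R 0] by simp
  ultimately show ?thesis
    unfolding nzf_iff using adjoin_submodule[OF submodule_R] d(1,2) zero_neq_one by metis
qed

subsection \<open>The \<open>v\<close>- and \<open>t\<close>-operations\<close>

lemma colon_submodule: "is_submodule R (colon R I)"
  by (auto simp: is_submodule_def colon_def distrib_right mult.assoc)

lemma colon_nzf:
  assumes "nonzero_fractional_ideal R I"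
  shows "nonzero_fractional_ideal R (colon R I)"
proof -
  obtain a where "a \<in> I" "a \<in> R" "a \<noteq> 0" using nzf_mem_R[OF assms] .
  moreover obtain d where "d \<in> R" "d \<noteq> 0" "\<forall>x\<in>I. d * x \<in> R"
    using assms by (auto simp: nzf_iff)
  ultimately show ?thesis
    unfolding nzf_iff using colon_submodule[of I]
    by (intro conjI bexI[of _ a] bexI[of _ d]) (auto simp: colon_def mult.commute)
qed

text \<open>The elements that a fixed \<open>x\<close> sends into \<open>R\<close> form a module, so
  multipliers do not distinguish a set from the module it generates. This lets
  \<open>v_closure\<close> be applied to bare finite sets.\<close>

lemma colon_hull: "colon R (is_submodule R hull S) = colon R S"
proof
  show "colon R (is_submodule R hull S) \<subseteq> colon R S"
    unfolding colon_def using hull_inc[of _ S "is_submodule R"] by blast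
  show "colon R S \<subseteq> colon R (is_submodule R hull S)"
  proof
    fix x assume x: "x \<in> colon R S"
    have "is_submodule R {y. x * y \<in> R}"
      unfolding is_submodule_def by (simp add: distrib_left mult.left_commute[of x] add_R mult_R)
    then have "is_submodule R hull S \<subseteq> {y. x * y \<in> R}"
      by (rule hull_minimal[rotated]) (use x in \<open>simp add: colon_def subset_iff\<close>)
    then show "x \<in> colon R (is_submodule R hull S)" by (auto simp: colon_def)
  qed
qed

lemma v_closure_hull: "v_closure R (is_submodule R hull S) = v_closure R S"
  by (simp add: v_closure_def colon_hull)

lemma mem_v_closure: "x \<in> v_closure R I \<longleftrightarrow> (\<forall>y. (\<forall>i\<in>I. y * i \<in> R) \<longrightarrow> x * y \<in> R)"
  by (auto simp: v_closure_def colon_def)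

lemma v_closure_submodule: "is_submodule R (v_closure R I)"
  by (simp add: v_closure_def colon_submodule)

lemma v_closure_nzf:
  "nonzero_fractional_ideal R I \<Longrightarrow> nonzero_fractional_ideal R (v_closure R I)"
  by (simp add: v_closure_def colon_nzf)

lemma v_closure_incr: "I \<subseteq> v_closure R I"
proof
  fix x assume "x \<in> I"
  then have "y * x \<in> R" if "\<forall>i\<in>I. y * i \<in> R" for y using that by blast
  then show "x \<in> v_closure R I" unfolding mem_v_closure mult.commute[of x] by blast
qed

lemma v_closure_mono: "I \<subseteq> J \<Longrightarrow> v_closure R I \<subseteq> v_closure R J"
  unfolding v_closure_def colon_def by blast

text \<open>Each element of \<open>J\<close> multiplies \<open>I\<close> into \<open>R\<close>,
  hence also the closure of \<open>I\<close>.\<close>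

lemma v_closure_least: "I \<subseteq> colon R J \<Longrightarrow> v_closure R I \<subseteq> colon R J"
proof
  fix x assume *: "I \<subseteq> colon R J" and x: "x \<in> v_closure R I"
  show "x \<in> colon R J"
    unfolding colon_def mem_Collect_eq
  proof
    fix y assume "y \<in> J"
    then have "y * i \<in> R" if "i \<in> I" for i
      using * that unfolding colon_def mult.commute[of y] by blast
    then show "x * y \<in> R" using x unfolding mem_v_closure by blast
  qed
qed

lemma v_closure_least_v: "I \<subseteq> v_closure R J \<Longrightarrow> v_closure R I \<subseteq> v_closure R J"
  unfolding v_closure_def[of R J] by (rule v_closure_least)

lemma v_closure_least_R: "I \<subseteq> R \<Longrightarrow> v_closure R I \<subseteq> R"
proof -
  have "x \<in> R" if "x \<in> colon R R" for x
    using that bspec[of R "\<lambda>y. x * y \<in> R" 1] by (simp add: colon_def)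
  then have "colon R R = R" by (auto simp: colon_def)
  then show "I \<subseteq> R \<Longrightarrow> v_closure R I \<subseteq> R" using v_closure_least[of I R] by simp
qed

lemma v_closure_scale:
  assumes "x \<in> v_closure R I" "\<forall>i\<in>I. c * i \<in> J"
  shows "c * x \<in> v_closure R J"
  unfolding mem_v_closure
proof (intro allI impI)
  fix y assume y: "\<forall>i\<in>J. y * i \<in> R"
  then have "x * (y * c) \<in> R"
    using assms unfolding mem_v_closure by (simp add: mult.assoc)
  then show "c * x * y \<in> R" by (simp add: ac_simps)
qed

lemma mem_t_closure:
  assumes "nonzero_fractional_ideal R I"
  shows "x \<in> t_closure R I \<longleftrightarrow> (\<exists>S. finite S \<and> S \<subseteq> I \<and> x \<in> v_closure R S)"
proof
  assume "x \<in> t_closure R I"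
  then obtain S where "finite S" "is_submodule R hull S \<subseteq> I" "x \<in> v_closure R (is_submodule R hull S)"
    by (auto simp: t_closure_def fin_generated_def)
  then show "\<exists>S. finite S \<and> S \<subseteq> I \<and> x \<in> v_closure R S"
    by (metis v_closure_hull hull_subset subset_trans)
next
  assume "\<exists>S. finite S \<and> S \<subseteq> I \<and> x \<in> v_closure R S"
  then obtain S where S: "finite S" "S \<subseteq> I" "x \<in> v_closure R S" by blast
  \<comment> \<open>The definition asks for a nonzero finitely generated ideal, while
    \<open>S\<close> may be empty or \<open>{0}\<close>; a nonzero element of \<open>I\<close>
    repairs this.\<close>
  obtain a where a: "a \<in> I" "a \<noteq> 0" using nzf_mem_R[OF assms] .
  let ?J = "is_submodule R hull (insert a S)"
  have J: "?J \<subseteq> I"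
    by (rule hull_minimal) (use S a nzf_submodule[OF assms] in auto)
  moreover have "nonzero_fractional_ideal R ?J"
    unfolding nzf_iff
    using a J assms submodule_hull hull_inc[of a "insert a S"] unfolding nzf_iff by blast
  moreover have "x \<in> v_closure R ?J"
    using S v_closure_mono[of S "insert a S"] by (auto simp: v_closure_hull)
  ultimately show "x \<in> t_closure R I"
    using S unfolding t_closure_def fin_generated_def by blast
qed

lemma t_closure_incr: "nonzero_fractional_ideal R I \<Longrightarrow> I \<subseteq> t_closure R I"
proof
  fix x assume "nonzero_fractional_ideal R I" "x \<in> I"
  then show "x \<in> t_closure R I"
    using v_closure_incr[of "{x}"] by (auto simp: mem_t_closure intro!: exI[of _ "{x}"])
qed

lemma t_closure_le_v: "nonzero_fractional_ideal R I \<Longrightarrow> t_closure R I \<subseteq> v_closure R I"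
  unfolding subset_iff mem_t_closure using v_closure_mono by blast

lemma t_closure_submodule:
  assumes "nonzero_fractional_ideal R I"
  shows "is_submodule R (t_closure R I)"
  unfolding is_submodule_def
proof (intro conjI ballI)
  show "0 \<in> t_closure R I"
    using t_closure_incr[OF assms] nzf_submodule[OF assms] by (auto simp: is_submodule_def)
next
  fix x y assume "x \<in> t_closure R I" "y \<in> t_closure R I"
  then obtain S T where "finite S" "S \<subseteq> I" "x \<in> v_closure R S" "finite T" "T \<subseteq> I" "y \<in> v_closure R T"
    by (auto simp: mem_t_closure[OF assms])
  then show "x + y \<in> t_closure R I"
    unfolding mem_t_closure[OF assms]
    using v_closure_mono[of S "S \<union> T"] v_closure_mono[of T "S \<union> T"]
    by (intro exI[of _ "S \<union> T"]) (auto intro!: submodule_add[OF v_closure_submodule])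
next
  fix r x assume "r \<in> R" "x \<in> t_closure R I"
  then show "r * x \<in> t_closure R I"
    unfolding mem_t_closure[OF assms] using submodule_mult[OF v_closure_submodule] by blast
qed

lemma t_closure_nzf:
  assumes "nonzero_fractional_ideal R I"
  shows "nonzero_fractional_ideal R (t_closure R I)"
  using t_closure_submodule[OF assms] t_closure_incr[OF assms] t_closure_le_v[OF assms]
    v_closure_nzf[OF assms] assms
  unfolding nzf_iff by (meson subset_iff)

text \<open>Each of finitely many elements needs only a finite part of \<open>J\<close>, and the
  union of these parts is finite. Idempotence of the \<open>t\<close>-closure follows.\<close>

lemma t_closure_least:
  assumes "nonzero_fractional_ideal R I" "nonzero_fractional_ideal R J" "I \<subseteq> t_closure R J"
  shows "t_closure R I \<subseteq> t_closure R J"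
proof
  fix x assume "x \<in> t_closure R I"
  then obtain S where S: "finite S" "S \<subseteq> I" "x \<in> v_closure R S"
    by (auto simp: mem_t_closure[OF assms(1)])
  have "\<forall>s\<in>S. \<exists>T. finite T \<and> T \<subseteq> J \<and> s \<in> v_closure R T"
    using S assms by (meson mem_t_closure subset_iff)
  then obtain T where T: "\<And>s. s \<in> S \<Longrightarrow> finite (T s) \<and> T s \<subseteq> J \<and> s \<in> v_closure R (T s)"
    by metis
  have "S \<subseteq> v_closure R (\<Union>(T ` S))"
  proof
    fix s assume "s \<in> S"
    then have "T s \<subseteq> \<Union>(T ` S)" by blast
    then show "s \<in> v_closure R (\<Union>(T ` S))"
      using T[OF \<open>s \<in> S\<close>] v_closure_mono by blast
  qed
  then have "x \<in> v_closure R (\<Union>(T ` S))"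
    using v_closure_least_v S by blast
  then show "x \<in> t_closure R J"
    unfolding mem_t_closure[OF assms(2)]
  proof (intro exI[of _ "\<Union>(T ` S)"] conjI)
    show "finite (\<Union>(T ` S))" using S(1) T by simp
    show "\<Union>(T ` S) \<subseteq> J" using T by (simp add: UN_subset_iff)
  qed
qed

lemma t_closure_mono:
  assumes "nonzero_fractional_ideal R I" "nonzero_fractional_ideal R J" "I \<subseteq> J"
  shows "t_closure R I \<subseteq> t_closure R J"
  using t_closure_least[OF assms(1,2)] t_closure_incr[OF assms(2)] assms(3) by blast

lemma t_ideal_t_closure: "nonzero_fractional_ideal R I \<Longrightarrow> t_ideal R (t_closure R I)"
  unfolding t_ideal_def
  using t_closure_incr[of "t_closure R I"] t_closure_least[of "t_closure R I" I] t_closure_nzf[of I]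
  by blast

lemma t_ideal_iff:
  "t_ideal R I \<longleftrightarrow> nonzero_fractional_ideal R I \<and> t_closure R I \<subseteq> I"
  unfolding t_ideal_def using t_closure_incr[of I] by blast

lemma t_closure_le_R:
  "nonzero_fractional_ideal R I \<Longrightarrow> I \<subseteq> R \<Longrightarrow> t_closure R I \<subseteq> R"
  using t_closure_le_v[of I] v_closure_least_R[of I] by simp

lemma nzf_integral_above:
  assumes "nonzero_fractional_ideal R I" "is_submodule R J" "I \<subseteq> J" "J \<subseteq> R"
  shows "nonzero_fractional_ideal R J"
  by (rule nzf_between[OF assms(1-3), of 1]) (use assms(4) in \<open>simp_all add: subset_iff\<close>)

lemma submodule_one_iff: "is_submodule R I \<Longrightarrow> I \<subseteq> R \<Longrightarrow> 1 \<in> I \<longleftrightarrow> I = R"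
  using submodule_mult[of I _ 1] one_R by (metis mult.right_neutral subsetI subset_antisym)

section \<open>Existence and primality of \<open>t\<close>-maximal ideals\<close>

lemma t_Max_above:
  assumes "nonzero_fractional_ideal R I" "I \<subseteq> R" "1 \<notin> t_closure R I"
  obtains M where "M \<in> t_Max R" "I \<subseteq> M"
proof -
  \<comment> \<open>The condition \<open>1 \<notin> t_closure R J\<close> passes to unions of
    chains, because a violation is witnessed by a finite set, which already lies in one member of
    the chain.\<close>
  define A where "A = {J. is_submodule R J \<and> I \<subseteq> J \<and> J \<subseteq> R \<and> 1 \<notin> t_closure R J}"
  have nzf: "nonzero_fractional_ideal R J" if "is_submodule R J" "I \<subseteq> J" "J \<subseteq> R" for J
    using nzf_integral_above[OF assms(1) that] .
  have "\<exists>M\<in>A. \<forall>U\<in>A. M \<subseteq> U \<longrightarrow> U = M"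
  proof (rule subset_Zorn_nonempty)
    show "A \<noteq> {}" using assms nzf_submodule by (auto simp: A_def)
  next
    fix C assume C: "C \<noteq> {}" "subset.chain A C"
    have CA: "C \<subseteq> A" using C by (auto simp: subset.chain_def)
    have sub: "is_submodule R (\<Union>C)"
      unfolding is_submodule_def
    proof (intro conjI ballI)
      show "0 \<in> \<Union>C" using C CA by (auto simp: A_def is_submodule_def)
    next
      fix x y assume "x \<in> \<Union>C" "y \<in> \<Union>C"
      then obtain U Y where XY: "U \<in> C" "Y \<in> C" "x \<in> U" "y \<in> Y" by blast
      then have "U \<subseteq> Y \<or> Y \<subseteq> U" using C by (auto simp: subset.chain_def)
      then obtain Z where "Z \<in> C" "x \<in> Z" "y \<in> Z" using XY by blast
      moreover from this have "is_submodule R Z" using CA by (auto simp: A_def)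
      ultimately show "x + y \<in> \<Union>C" using submodule_add by blast
    next
      fix r x assume r: "r \<in> R" and "x \<in> \<Union>C"
      then obtain U where "U \<in> C" "x \<in> U" by blast
      moreover from this have "is_submodule R U" using CA by (auto simp: A_def)
      ultimately show "r * x \<in> \<Union>C" using submodule_mult r by blast
    qed
    have bd: "I \<subseteq> \<Union>C" "\<Union>C \<subseteq> R" using C CA by (auto simp: A_def)
    have "1 \<notin> t_closure R (\<Union>C)"
    proof
      assume "1 \<in> t_closure R (\<Union>C)"
      then obtain S where S: "finite S" "S \<subseteq> \<Union>C" "1 \<in> v_closure R S"
        using nzf[OF sub bd] by (auto simp: mem_t_closure)
      obtain U where "U \<in> C" "S \<subseteq> U"
        using finite_subset_Union_chain[OF S(1,2) C] by blast
      then show False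
        using CA S nzf mem_t_closure[of U 1] by (auto simp: A_def)
    qed
    then show "\<Union>C \<in> A" using sub bd by (auto simp: A_def)
  qed
  then obtain M where M: "M \<in> A" "\<And>U. U \<in> A \<Longrightarrow> M \<subseteq> U \<Longrightarrow> U = M" by blast
  have nM: "nonzero_fractional_ideal R M" "M \<subseteq> R" "I \<subseteq> M" "1 \<notin> t_closure R M"
    using M nzf by (auto simp: A_def)
  have tt: "t_closure R (t_closure R M) = t_closure R M"
    using t_ideal_t_closure[OF nM(1)] by (simp add: t_ideal_def)
  \<comment> \<open>By idempotence the \<open>t\<close>-closure of the maximal member stays in
    \<open>A\<close>, so that member is a \<open>t\<close>-ideal.\<close>
  have "t_closure R M \<in> A"
    using nM t_closure_incr[OF nM(1)] t_closure_submodule[OF nM(1)] t_closure_le_R[OF nM(1,2)] tt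
    by (auto simp: A_def)
  then have tM: "t_closure R M = M" using M(2) t_closure_incr[OF nM(1)] by blast
  have "M \<in> t_Max R"
    unfolding t_Max_def mem_Collect_eq
  proof (intro conjI allI impI)
    show "t_ideal R M" using nM tM by (simp add: t_ideal_def)
    show "M \<subset> R" using nM tM by (metis one_R psubsetI)
  next
    fix J assume J: "t_ideal R J \<and> J \<subset> R \<and> M \<subseteq> J"
    then have "is_submodule R J" by (auto simp: t_ideal_def nzf_submodule)
    then have "J \<in> A"
      using J nM submodule_one_iff[of J] by (auto simp: A_def t_ideal_def)
    then show "J = M" using M(2) J by blast
  qed
  then show ?thesis using that nM by blast
qed

lemma t_Max_D:
  assumes "M \<in> t_Max R"
  shows "t_ideal R M" "nonzero_fractional_ideal R M" "is_submodule R M" "M \<subseteq> R" "1 \<notin> M"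
proof -
  show 1: "t_ideal R M" and 2: "M \<subseteq> R" using assms by (auto simp: t_Max_def)
  show 3: "nonzero_fractional_ideal R M" using 1 by (simp add: t_ideal_def)
  show 4: "is_submodule R M" using 3 nzf_submodule by simp
  show "1 \<notin> M" using submodule_one_iff[OF 4 2] assms by (auto simp: t_Max_def)
qed

lemma t_Max_incomparable:
  assumes "M \<in> t_Max R" "N \<in> t_Max R" "M \<noteq> N"
  obtains x where "x \<in> M" "x \<notin> N"
proof -
  have "\<not> M \<subseteq> N" using assms by (auto simp: t_Max_def)
  then show ?thesis using that by blast
qed

lemma t_Max_sup:
  assumes M: "M \<in> t_Max R" and J: "is_submodule R J" "M \<subseteq> J" "J \<subseteq> R" "J \<noteq> M"
  shows "1 \<in> t_closure R J"
proof (rule ccontr)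
  assume 1: "1 \<notin> t_closure R J"
  have nJ: "nonzero_fractional_ideal R J"
    using nzf_integral_above[OF t_Max_D(2)[OF M] J(1-3)] .
  obtain N where N: "N \<in> t_Max R" "J \<subseteq> N" using t_Max_above[OF nJ J(3) 1] .
  then have "N = M" using M J(2) by (simp add: t_Max_def)
  then show False using N J by blast
qed

text \<open>If \<open>b\<close> is outside \<open>M\<close>, maximality puts \<open>1\<close> into
  the \<open>t\<close>-closure of \<open>M + b R\<close>, witnessed by a finite \<open>S\<close>.
  Multiplication by \<open>a\<close> puts \<open>a\<close> into the \<open>v\<close>-closure of
  \<open>a S\<close>, and \<open>a S\<close> lies in \<open>M\<close> because \<open>a * b\<close>
  does.\<close>

lemma t_Max_prime:
  assumes M: "M \<in> t_Max R"
  shows "prime_of R M"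
  unfolding prime_of_def
proof (intro conjI ballI impI)
  note D = t_Max_D[OF M]
  show "is_submodule R M" "M \<subseteq> R" "1 \<notin> M" using D by auto
  fix a b assume ab: "a \<in> R" "b \<in> R" "a * b \<in> M"
  show "a \<in> M \<or> b \<in> M"
  proof (rule disjCI)
    assume b: "b \<notin> M"
    define J where "J = adjoin M b"
    have subJ: "is_submodule R J" unfolding J_def by (rule adjoin_submodule[OF D(3)])
    have MJ: "M \<subseteq> J" using adjoinI[of _ M 0 b] unfolding J_def by auto
    have "b \<in> J" using adjoinI[of 0 M 1 b] submodule_zero[OF D(3)] unfolding J_def by simp
    moreover have JR: "J \<subseteq> R" using D(4) ab(2) by (auto simp: J_def elim!: adjoinE)
    ultimately have "1 \<in> t_closure R J"
      using subJ MJ b by (intro t_Max_sup[OF M]) blast+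
    moreover have "nonzero_fractional_ideal R J"
      using nzf_integral_above[OF D(2) subJ MJ JR] .
    ultimately obtain S where S: "finite S" "S \<subseteq> J" "1 \<in> v_closure R S"
      by (auto simp: mem_t_closure)
    have aS: "(*) a ` S \<subseteq> M"
    proof
      fix y assume "y \<in> (*) a ` S"
      then obtain s where "s \<in> S" "y = a * s" by blast
      moreover obtain m r where "m \<in> M" "r \<in> R" "s = m + r * b"
        using S \<open>s \<in> S\<close> unfolding J_def by (blast elim: adjoinE)
      ultimately have "y = a * m + r * (a * b)" by (simp add: algebra_simps)
      then show "y \<in> M"
        using \<open>m \<in> M\<close> \<open>r \<in> R\<close> ab submodule_add[OF D(3)] submodule_mult[OF D(3)] by simp
    qed
    have "a * 1 \<in> v_closure R ((*) a ` S)" by (rule v_closure_scale[OF S(3)]) blast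
    then have "a \<in> t_closure R M"
      unfolding mem_t_closure[OF D(2)] using S(1) aS by (metis finite_imageI mult.right_neutral)
    then show "a \<in> M" using D(1) by (simp add: t_ideal_def)
  qed
qed

subsection \<open>Localization\<close>

lemma prime_of_compl_mult:
  "prime_of R P \<Longrightarrow> s \<in> R \<Longrightarrow> s \<notin> P \<Longrightarrow> t \<in> R \<Longrightarrow> t \<notin> P \<Longrightarrow> s * t \<in> R \<and> s * t \<notin> P"
  unfolding prime_of_def using mult_R by blast

lemma prime_of_D:
  assumes "prime_of R P"
  shows "is_submodule R P" "P \<subseteq> R" "1 \<notin> P" "0 \<in> P"
  using assms by (simp_all add: prime_of_def is_submodule_def)

lemma mem_localization:
  assumes "0 \<in> P"
  shows "x \<in> localization R P \<longleftrightarrow> (\<exists>s\<in>R. s \<notin> P \<and> s * x \<in> R)"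
proof
  assume "x \<in> localization R P"
  then obtain a s where "a \<in> R" "s \<in> R" "s \<notin> P" "x = a / s" by (auto simp: localization_def)
  moreover have "s \<noteq> 0" using assms \<open>s \<notin> P\<close> by auto
  ultimately have "s * x = a" by simp
  then show "\<exists>s\<in>R. s \<notin> P \<and> s * x \<in> R"
    using \<open>a \<in> R\<close> \<open>s \<in> R\<close> \<open>s \<notin> P\<close> by blast
next
  assume "\<exists>s\<in>R. s \<notin> P \<and> s * x \<in> R"
  then obtain s where s: "s \<in> R" "s \<notin> P" "s * x \<in> R" by blast
  have "s \<noteq> 0" using assms \<open>s \<notin> P\<close> by auto
  then have "x = (s * x) / s" by simp
  moreover have "(s * x) / s \<in> localization R P" using s unfolding localization_def by blast
  ultimately show "x \<in> localization R P" by simp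
qed

text \<open>Finite sums have a common denominator outside \<open>P\<close>, so the elements that
  some such denominator carries into \<open>I\<close> already form a module; the hull in
  \<open>ideal_mult\<close> thus becomes one existential.\<close>

lemma mem_mult_localization:
  assumes P: "prime_of R P" and I: "is_submodule R I"
  shows "x \<in> ideal_mult R I (localization R P) \<longleftrightarrow> (\<exists>s\<in>R. s \<notin> P \<and> s * x \<in> I)"
proof
  note D = prime_of_D[OF P]
  define T where "T = {x. \<exists>s\<in>R. s \<notin> P \<and> s * x \<in> I}"
  have "is_submodule R T"
    unfolding is_submodule_def
  proof (intro conjI ballI)
    show "0 \<in> T" using D submodule_zero[OF I] by (auto simp: T_def)
  next
    fix x y assume "x \<in> T" "y \<in> T"
    then obtain s t where "s \<in> R" "s \<notin> P" "s * x \<in> I" "t \<in> R" "t \<notin> P" "t * y \<in> I"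
      by (auto simp: T_def)
    moreover from this have "t * (s * x) + s * (t * y) \<in> I"
      using submodule_add[OF I] submodule_mult[OF I] by blast
    ultimately show "x + y \<in> T"
      using prime_of_compl_mult[OF P, of s t] unfolding T_def
      by (auto simp: algebra_simps intro!: bexI[of _ "s * t"])
  next
    fix r x assume "r \<in> R" "x \<in> T"
    then show "r * x \<in> T"
      using submodule_mult[OF I] unfolding T_def mem_Collect_eq by (metis mult.left_commute)
  qed
  moreover have "{x * y |x y. x \<in> I \<and> y \<in> localization R P} \<subseteq> T"
  proof clarify
    fix x y assume "x \<in> I" "y \<in> localization R P"
    then obtain s where s: "s \<in> R" "s \<notin> P" "s * y \<in> R" using mem_localization D by blast
    then have "s * (x * y) \<in> I"
      using submodule_mult[OF I s(3) \<open>x \<in> I\<close>] by (simp add: ac_simps)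
    then show "x * y \<in> T" using s by (auto simp: T_def)
  qed
  ultimately have "ideal_mult R I (localization R P) \<subseteq> T"
    unfolding ideal_mult_def by (intro hull_minimal)
  then show "x \<in> ideal_mult R I (localization R P) \<Longrightarrow> \<exists>s\<in>R. s \<notin> P \<and> s * x \<in> I"
    by (auto simp: T_def)
next
  assume "\<exists>s\<in>R. s \<notin> P \<and> s * x \<in> I"
  then obtain s where s: "s \<in> R" "s \<notin> P" "s * x \<in> I" by blast
  have "s \<noteq> 0" using s prime_of_D[OF P] by auto
  then have "x = (s * x) * (1 / s)" by simp
  moreover have "1 / s \<in> localization R P" using s one_R unfolding localization_def by blast
  ultimately have "x \<in> {x * y |x y. x \<in> I \<and> y \<in> localization R P}"
    using s(3) by (metis (mono_tags, lifting) mem_Collect_eq)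
  then show "x \<in> ideal_mult R I (localization R P)"
    unfolding ideal_mult_def by (rule hull_inc)
qed

text \<open>If \<open>x\<close> is not in \<open>R\<close>, the denominator ideal of
  \<open>x\<close> is a proper divisorial ideal, hence lies in some \<open>t\<close>-maximal
  \<open>M\<close>, and no denominator of \<open>x\<close> is left outside \<open>M\<close>.\<close>

lemma mem_R_locally:
  assumes "\<And>M. M \<in> t_Max R \<Longrightarrow> \<exists>s\<in>R. s \<notin> M \<and> s * x \<in> R"
  shows "x \<in> R"
proof (rule ccontr)
  assume x: "x \<notin> R"
  define I where "I = colon R {1, x}"
  have memI: "s \<in> I \<longleftrightarrow> s \<in> R \<and> s * x \<in> R" for s by (auto simp: I_def colon_def)
  have sub: "is_submodule R I" by (simp add: I_def colon_submodule)
  obtain b where "b \<in> R" "b \<noteq> 0" "b * x \<in> R" using denominator by blast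
  then have nI: "nonzero_fractional_ideal R I"
    using sub by (intro nzf_integral[of I b]) (auto simp: memI)
  have "v_closure R I \<subseteq> I" unfolding I_def by (rule v_closure_least) simp
  then have "1 \<notin> t_closure R I" using x memI[of 1] t_closure_le_v[OF nI] by auto
  then obtain M where "M \<in> t_Max R" "I \<subseteq> M" using t_Max_above[OF nI] memI by blast
  then show False using assms[of M] memI by blast
qed

subsection \<open>The \<open>w\<close>-operation\<close>

lemma mem_w_closure:
  assumes "is_submodule R I"
  shows "x \<in> w_closure R I \<longleftrightarrow> (\<forall>M\<in>t_Max R. \<exists>s\<in>R. s \<notin> M \<and> s * x \<in> I)"
  unfolding w_closure_def INT_iff
  by (intro ball_cong refl mem_mult_localization t_Max_prime assms)

lemma w_closure_incr:
  assumes "is_submodule R I"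
  shows "I \<subseteq> w_closure R I"
proof
  fix x assume "x \<in> I"
  show "x \<in> w_closure R I"
    unfolding mem_w_closure[OF assms]
  proof
    fix M assume "M \<in> t_Max R"
    then show "\<exists>s\<in>R. s \<notin> M \<and> s * x \<in> I"
      using \<open>x \<in> I\<close> t_Max_D(5) by (intro bexI[of _ 1]) simp_all
  qed
qed

lemma w_closure_submodule:
  assumes I: "is_submodule R I"
  shows "is_submodule R (w_closure R I)"
  unfolding is_submodule_def
proof (intro conjI ballI)
  show "0 \<in> w_closure R I" using w_closure_incr[OF I] submodule_zero[OF I] by blast
next
  fix x y assume x: "x \<in> w_closure R I" and y: "y \<in> w_closure R I"
  show "x + y \<in> w_closure R I"
    unfolding mem_w_closure[OF I]
  proof
    fix M assume M: "M \<in> t_Max R"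
    obtain s t where s: "s \<in> R" "s \<notin> M" "s * x \<in> I" and t: "t \<in> R" "t \<notin> M" "t * y \<in> I"
      using x y M unfolding mem_w_closure[OF I] by blast
    have "t * (s * x) + s * (t * y) \<in> I"
      using submodule_add[OF I] submodule_mult[OF I] s t by simp
    then have "s * t * (x + y) \<in> I" by (simp add: algebra_simps)
    then show "\<exists>s\<in>R. s \<notin> M \<and> s * (x + y) \<in> I"
      using prime_of_compl_mult[OF t_Max_prime[OF M] s(1,2) t(1,2)] by blast
  qed
next
  fix r x assume r: "r \<in> R" and x: "x \<in> w_closure R I"
  show "r * x \<in> w_closure R I"
    unfolding mem_w_closure[OF I]
  proof
    fix M assume M: "M \<in> t_Max R"
    obtain s where s: "s \<in> R" "s \<notin> M" "s * x \<in> I"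
      using x M unfolding mem_w_closure[OF I] by blast
    then have "s * (r * x) \<in> I"
      using submodule_mult[OF I r s(3)] by (simp add: mult.left_commute)
    then show "\<exists>s\<in>R. s \<notin> M \<and> s * (r * x) \<in> I" using s by blast
  qed
qed

lemma w_closure_nzf:
  assumes "nonzero_fractional_ideal R I"
  shows "nonzero_fractional_ideal R (w_closure R I)"
proof -
  note I = nzf_submodule[OF assms]
  obtain d where d: "d \<in> R" "d \<noteq> 0" "\<forall>x\<in>I. d * x \<in> R"
    using assms unfolding nzf_iff by blast
  have "d * x \<in> R" if x: "x \<in> w_closure R I" for x
  proof (rule mem_R_locally)
    fix M assume "M \<in> t_Max R"
    then obtain s where s: "s \<in> R" "s \<notin> M" "s * x \<in> I"
      using x unfolding mem_w_closure[OF I] by blast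
    then have "s * (d * x) \<in> R" using d(3) by (simp add: mult.left_commute)
    then show "\<exists>s\<in>R. s \<notin> M \<and> s * (d * x) \<in> R" using s by blast
  qed
  then show ?thesis
    using nzf_between[OF assms w_closure_submodule[OF I] w_closure_incr[OF I] d(1,2)] by blast
qed

lemma w_ideal_w_closure:
  assumes "nonzero_fractional_ideal R I"
  shows "w_ideal R (w_closure R I)"
  unfolding w_ideal_def
proof (intro conjI subset_antisym w_closure_nzf assms)
  note I = nzf_submodule[OF assms]
  note W = w_closure_submodule[OF I]
  show "w_closure R I \<subseteq> w_closure R (w_closure R I)" by (rule w_closure_incr[OF W])
  show "w_closure R (w_closure R I) \<subseteq> w_closure R I"
  proof
    fix x assume x: "x \<in> w_closure R (w_closure R I)"
    show "x \<in> w_closure R I"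
      unfolding mem_w_closure[OF I]
    proof
      fix M assume M: "M \<in> t_Max R"
      obtain s where s: "s \<in> R" "s \<notin> M" "s * x \<in> w_closure R I"
        using x M unfolding mem_w_closure[OF W] by blast
      obtain t where t: "t \<in> R" "t \<notin> M" "t * (s * x) \<in> I"
        using s(3) M unfolding mem_w_closure[OF I] by blast
      have "t * s * x \<in> I" using t(3) by (simp add: mult.assoc)
      then show "\<exists>s\<in>R. s \<notin> M \<and> s * x \<in> I"
        using prime_of_compl_mult[OF t_Max_prime[OF M] t(1,2) s(1,2)] by blast
    qed
  qed
qed

text \<open>The ideal \<open>A\<close> of all \<open>s\<close> with \<open>s * x\<close> in
  \<open>I\<close> lies in no \<open>t\<close>-maximal ideal, so \<open>1\<close> is in the
  \<open>v\<close>-closure of a finite \<open>S \<subseteq> A\<close>. Multiplying by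
  \<open>x\<close> gives a finite subset of \<open>I\<close> whose \<open>v\<close>-closure contains
  \<open>x\<close>.\<close>

lemma w_closure_le_t:
  assumes "nonzero_fractional_ideal R I"
  shows "w_closure R I \<subseteq> t_closure R I"
proof
  note I = nzf_submodule[OF assms]
  fix x assume x: "x \<in> w_closure R I"
  define A where "A = {s \<in> R. s * x \<in> I}"
  have subA: "is_submodule R A"
    unfolding is_submodule_def A_def
    using submodule_zero[OF I] submodule_add[OF I] submodule_mult[OF I]
    by (auto simp: distrib_right mult.assoc)
  obtain i where i: "i \<in> I" "i \<in> R" "i \<noteq> 0" using nzf_mem_R[OF assms] .
  obtain b where b: "b \<in> R" "b \<noteq> 0" "b * x \<in> R" using denominator by blast
  have "(i * b) * x \<in> I" using submodule_mult'[OF I i(1) b(3)] by (simp add: mult.assoc)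
  then have nA: "nonzero_fractional_ideal R A"
    using i b by (intro nzf_integral[OF subA, of "i * b"]) (auto simp: A_def)
  have "1 \<in> t_closure R A"
  proof (rule ccontr)
    assume "1 \<notin> t_closure R A"
    then obtain M where "M \<in> t_Max R" "A \<subseteq> M"
      using t_Max_above[OF nA] by (auto simp: A_def)
    then show False using x unfolding mem_w_closure[OF I] A_def by blast
  qed
  then obtain S where S: "finite S" "S \<subseteq> A" "1 \<in> v_closure R S"
    unfolding mem_t_closure[OF nA] by blast
  have "x * 1 \<in> v_closure R ((*) x ` S)" by (rule v_closure_scale[OF S(3)]) blast
  moreover have "(*) x ` S \<subseteq> I" using S(2) by (auto simp: A_def mult.commute)
  ultimately show "x \<in> t_closure R I"
    unfolding mem_t_closure[OF assms] using S(1) by (metis finite_imageI mult.right_neutral)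
qed

text \<open>\<open>w_closure R I\<close> is a \<open>w\<close>-ideal, hence divisorial, and it
  contains \<open>I\<close>.\<close>

lemma v_closure_le_w:
  assumes "w_divisorial_domain R" "nonzero_fractional_ideal R I"
  shows "v_closure R I \<subseteq> w_closure R I"
proof -
  have "v_closure R (w_closure R I) = w_closure R I"
    using assms w_ideal_w_closure by (simp add: w_divisorial_domain_def divisorial_def)
  then show ?thesis
    using v_closure_mono[OF w_closure_incr[OF nzf_submodule[OF assms(2)]]] by simp
qed

subsection \<open>Prime ideals and valuation localizations\<close>

lemma cring_ring_on: "cring (ring_on R)"
proof (rule cringI)
  show "abelian_group (ring_on R)"
  proof (rule abelian_groupI)
    fix x assume "x \<in> carrier (ring_on R)"
    then show "\<exists>y\<in>carrier (ring_on R). y \<oplus>\<^bsub>ring_on R\<^esub> x = \<zero>\<^bsub>ring_on R\<^esub>"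
      by (intro bexI[of _ "- x"]) (auto simp: ring_of_type_algebra_simps)
  qed (auto simp: ring_of_type_algebra_simps)
  show "comm_monoid (ring_on R)"
    by (rule comm_monoidI) (auto simp: ring_of_type_algebra_simps)
qed (auto simp: ring_of_type_algebra_simps distrib_right)

lemma primeideal_iff: "primeideal P (ring_on R) \<longleftrightarrow> prime_of R P"
proof
  assume "primeideal P (ring_on R)"
  then interpret primeideal P "ring_on R" .
  note closed = additive_subgroup.a_closed[OF additive_subgroup_axioms]
    additive_subgroup.zero_closed[OF additive_subgroup_axioms]
  have "1 \<notin> P"
    using I_notcarr one_imp_carrier by (auto simp: ring_of_type_algebra_simps)
  then show "prime_of R P"
    unfolding prime_of_def is_submodule_def
    using I_prime a_subset closed I_l_closed by (auto simp: ring_of_type_algebra_simps)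
next
  assume P: "prime_of R P"
  note D = prime_of_D[OF P]
  show "primeideal P (ring_on R)"
  proof (rule primeidealI2[OF _ cring_ring_on])
    interpret cring "ring_on R" by (rule cring_ring_on)
    show "additive_subgroup P (ring_on R)"
    proof (rule additive_subgroupI, rule add.subgroupI)
      fix x assume "x \<in> P"
      have "\<ominus>\<^bsub>ring_on R\<^esub> x = - x"
        using D \<open>x \<in> P\<close> by (intro minus_equality) (auto simp: ring_of_type_algebra_simps)
      then show "\<ominus>\<^bsub>ring_on R\<^esub> x \<in> P" using submodule_uminus[OF D(1) \<open>x \<in> P\<close>] by simp
    next
      fix x y assume "x \<in> P" "y \<in> P"
      then show "x \<oplus>\<^bsub>ring_on R\<^esub> y \<in> P"
        using submodule_add[OF D(1)] by (simp add: ring_of_type_algebra_simps)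
    qed (use D(2,4) in \<open>auto simp: ring_of_type_algebra_simps\<close>)
  next
    fix a x assume "a \<in> P" "x \<in> carrier (ring_on R)"
    then show "x \<otimes>\<^bsub>ring_on R\<^esub> a \<in> P" "a \<otimes>\<^bsub>ring_on R\<^esub> x \<in> P"
      using submodule_mult[OF D(1)] submodule_mult'[OF D(1)] by (simp_all add: ring_of_type_algebra_simps)
  next
    show "carrier (ring_on R) \<noteq> P" using D(3) one_R by auto
  next
    fix a b assume "a \<in> carrier (ring_on R)" "b \<in> carrier (ring_on R)" "a \<otimes>\<^bsub>ring_on R\<^esub> b \<in> P"
    then show "a \<in> P \<or> b \<in> P" using P by (simp add: ring_of_type_algebra_simps prime_of_def)
  qed
qed

lemma subring_localization:
  assumes P: "prime_of R P"
  shows "subring (localization R P) ring_of_type_algebra"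
proof (rule ring.subringI[OF ring_from_type_algebra])
  note D = prime_of_D[OF P]
  note mem = mem_localization[OF D(4)]
  \<comment> \<open>One denominator for both elements and their product serves sums as well as
    products.\<close>
  have comb: "\<exists>u\<in>R. u \<notin> P \<and> u * x \<in> R \<and> u * y \<in> R \<and> u * (x * y) \<in> R"
    if x: "x \<in> localization R P" and y: "y \<in> localization R P" for x y
  proof -
    obtain s t where s: "s \<in> R" "s \<notin> P" "s * x \<in> R" and t: "t \<in> R" "t \<notin> P" "t * y \<in> R"
      using x y unfolding mem by blast
    have "s * t * x \<in> R" "s * t * y \<in> R" "s * t * (x * y) \<in> R"
      using mult_R[OF t(1) s(3)] mult_R[OF s(1) t(3)] mult_R[OF s(3) t(3)] by (simp_all add: ac_simps)
    then show ?thesis using prime_of_compl_mult[OF P s(1,2) t(1,2)] by blast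
  qed
  show "localization R P \<subseteq> carrier ring_of_type_algebra"
    by (simp add: ring_of_type_algebra_simps)
  show "\<one>\<^bsub>ring_of_type_algebra\<^esub> \<in> localization R P"
    unfolding mem ring_of_type_algebra_simps using D(3) by (intro bexI[of _ 1]) simp_all
  fix x assume x: "x \<in> localization R P"
  obtain s where s: "s \<in> R" "s \<notin> P" "s * x \<in> R" using x unfolding mem by blast
  have "s * - x \<in> R" using uminus_R[OF s(3)] by simp
  then have "- x \<in> localization R P" using s(1,2) unfolding mem by blast
  then show "\<ominus>\<^bsub>ring_of_type_algebra\<^esub> x \<in> localization R P"
    by (simp add: a_inv_ring_of_type_algebra)
  fix y assume y: "y \<in> localization R P"
  show "x \<otimes>\<^bsub>ring_of_type_algebra\<^esub> y \<in> localization R P"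
    using comb[OF x y] unfolding mem ring_of_type_algebra_simps by blast
  show "x \<oplus>\<^bsub>ring_of_type_algebra\<^esub> y \<in> localization R P"
    using comb[OF x y] unfolding mem ring_of_type_algebra_simps distrib_left by blast
qed

section \<open>Divisibility in the valuation rings at \<open>t\<close>-maximal ideals\<close>

lemma valuation_localization_iff:
  assumes P: "prime_of R P"
  shows "valuation_domain (localization R P) \<longleftrightarrow>
     (\<forall>x. x \<noteq> 0 \<longrightarrow> (\<exists>s\<in>R. s \<notin> P \<and> s * x \<in> R) \<or> (\<exists>s\<in>R. s \<notin> P \<and> s * inverse x \<in> R))"
  using subring_localization[OF P]
  unfolding valuation_domain_def mem_localization[OF prime_of_D(4)[OF P]]
  by (simp only: simp_thms)

text \<open>Comparability of \<open>a\<close> and \<open>b\<close> under divisibility in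
  \<open>R_M\<close>, written without fractions so that zero needs no separate treatment
  later.\<close>

lemma PvMD_cases:
  assumes "PvMD R" and M: "M \<in> t_Max R"
  obtains s r where "s \<in> R" "s \<notin> M" "r \<in> R" "s * a = r * b"
  | s r where "s \<in> R" "s \<notin> M" "r \<in> R" "s * b = r * a"
proof -
  consider "a = 0" | "b = 0" | "a \<noteq> 0" "b \<noteq> 0" by blast
  then show thesis
  proof cases
    case 1
    then show ?thesis using that(1)[of 1 0] t_Max_D(5)[OF M] by simp
  next
    case 2
    then show ?thesis using that(2)[of 1 0] t_Max_D(5)[OF M] by simp
  next
    case 3
    then have "a / b \<noteq> 0" by simp
    have "valuation_domain (localization R M)" using assms by (simp add: PvMD_def)
    note this[unfolded valuation_localization_iff[OF t_Max_prime[OF M]], rule_format, OF \<open>a / b \<noteq> 0\<close>]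
    then show ?thesis
    proof
      assume "\<exists>s\<in>R. s \<notin> M \<and> s * (a / b) \<in> R"
      then obtain s where "s \<in> R" "s \<notin> M" "s * (a / b) \<in> R" by blast
      moreover have "s * a = s * (a / b) * b" using 3 by simp
      ultimately show ?thesis by (rule that(1))
    next
      assume "\<exists>s\<in>R. s \<notin> M \<and> s * inverse (a / b) \<in> R"
      then obtain s where "s \<in> R" "s \<notin> M" "s * inverse (a / b) \<in> R" by blast
      moreover have "s * b = s * inverse (a / b) * a" using 3 by simp
      ultimately show ?thesis by (rule that(2))
    qed
  qed
qed

text \<open>Locally at \<open>M\<close> a finite \<open>S \<subseteq> P\<close> is generated by a
  single \<open>a\<close> in \<open>P\<close>, so \<open>s / a\<close> multiplies \<open>S\<close>
  into \<open>R\<close> for some \<open>s\<close> outside \<open>M\<close>. For \<open>x\<close> in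
  the \<open>v\<close>-closure of \<open>S\<close> this gives \<open>s * x\<close> in
  \<open>a R \<subseteq> P\<close>, and \<open>s\<close> is outside \<open>P\<close>.\<close>

lemma prime_of_t_prime:
  assumes "PvMD R" and M: "M \<in> t_Max R" and P: "prime_of R P" "P \<subseteq> M" and p: "p \<in> P" "p \<noteq> 0"
  shows "t_prime R P"
proof -
  note D = prime_of_D[OF P(1)] and pM = t_Max_prime[OF M]
  have nP: "nonzero_fractional_ideal R P" using nzf_integral[OF D(1,2) p] .
  have principal: "\<exists>a\<in>P. a \<noteq> 0 \<and> (\<exists>s\<in>R. s \<notin> M \<and> (\<forall>x\<in>S. \<exists>r\<in>R. s * x = r * a))"
    if "finite S" "S \<subseteq> P" for S
    using that
  proof (induction S rule: finite_induct)
    case empty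
    then show ?case using p t_Max_D(5)[OF M] one_R by blast
  next
    case (insert y S)
    have "S \<subseteq> P" using insert.prems by simp
    from insert.IH[OF this] obtain a s where a: "a \<in> P" "a \<noteq> 0" and s: "s \<in> R" "s \<notin> M"
      and S: "\<forall>x\<in>S. \<exists>r\<in>R. s * x = r * a" by blast
    show ?case
    proof (rule PvMD_cases[OF assms(1) M, of a y])
      \<comment> \<open>Here \<open>y\<close> divides \<open>a\<close> locally and takes over as the
        generator.\<close>
      fix u r assume u: "u \<in> R" "u \<notin> M" "r \<in> R" "u * a = r * y"
      have "u \<noteq> 0" using u submodule_zero[OF t_Max_D(3)[OF M]] by blast
      then have "y \<noteq> 0" using u a by auto
      moreover have "\<forall>x\<in>insert y S. \<exists>r'\<in>R. s * u * x = r' * y"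
      proof
        fix x assume "x \<in> insert y S"
        show "\<exists>r'\<in>R. s * u * x = r' * y"
        proof (cases "x = y")
          case True
          then show ?thesis using s(1) u(1) by blast
        next
          case False
          then obtain c where "c \<in> R" "s * x = c * a" using S \<open>x \<in> insert y S\<close> by blast
          have "s * u * x = u * (s * x)" by (simp add: ac_simps)
          also have "\<dots> = c * (u * a)" unfolding \<open>s * x = c * a\<close> by (simp add: ac_simps)
          finally have "s * u * x = (c * r) * y" unfolding u(4) by (simp add: ac_simps)
          then show ?thesis using \<open>c \<in> R\<close> u(3) by blast
        qed
      qed
      moreover have "s * u \<in> R \<and> s * u \<notin> M" by (rule prime_of_compl_mult[OF pM s u(1,2)])
      ultimately show ?thesis using insert.prems by blast
    next
      fix u r assume u: "u \<in> R" "u \<notin> M" "r \<in> R" "u * y = r * a"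
      have "\<forall>x\<in>insert y S. \<exists>r'\<in>R. s * u * x = r' * a"
      proof
        fix x assume "x \<in> insert y S"
        show "\<exists>r'\<in>R. s * u * x = r' * a"
        proof (cases "x = y")
          case True
          then have "s * u * x = (s * r) * a" using u(4) by (simp add: mult.assoc)
          then show ?thesis using s(1) u(3) by blast
        next
          case False
          then obtain c where "c \<in> R" "s * x = c * a" using S \<open>x \<in> insert y S\<close> by blast
          have "s * u * x = u * (s * x)" by (simp add: ac_simps)
          then have "s * u * x = (u * c) * a" unfolding \<open>s * x = c * a\<close> by (simp add: ac_simps)
          then show ?thesis using \<open>c \<in> R\<close> u(1) by blast
        qed
      qed
      moreover have "s * u \<in> R \<and> s * u \<notin> M" by (rule prime_of_compl_mult[OF pM s u(1,2)])
      ultimately show ?thesis using a by blast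
    qed
  qed
  have "t_closure R P \<subseteq> P"
  proof
    fix x assume x: "x \<in> t_closure R P"
    obtain S where S: "finite S" "S \<subseteq> P" "x \<in> v_closure R S"
      using x unfolding mem_t_closure[OF nP] by blast
    obtain a s where a: "a \<in> P" "a \<noteq> 0" and s: "s \<in> R" "s \<notin> M"
      and aS: "\<forall>x\<in>S. \<exists>r\<in>R. s * x = r * a"
      using principal[OF S(1,2)] by blast
    have "s / a * i \<in> R" if "i \<in> S" for i
    proof -
      obtain r where "r \<in> R" "s * i = r * a" using aS \<open>i \<in> S\<close> by blast
      then show ?thesis using a(2) by simp
    qed
    then have "x * (s / a) \<in> R" using S(3) unfolding mem_v_closure by blast
    then have "x * (s / a) * a \<in> P" by (rule submodule_mult[OF D(1) _ a(1)])
    then have "s * x \<in> P" using a(2) by (simp add: mult.commute)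
    moreover have "x \<in> R" using x t_closure_le_R[OF nP D(2)] by blast
    ultimately show "x \<in> P" using P s unfolding prime_of_def by blast
  qed
  then show ?thesis
    unfolding t_prime_def primeideal_iff t_ideal_iff using P(1) nP by simp
qed

text \<open>The conclusion says that \<open>x\<close> is a unit of the composite ring
  \<open>R_M R_N\<close>. Otherwise the non-units of that ring in \<open>R\<close> form a prime
  \<open>P\<close> inside \<open>M\<close> and \<open>N\<close> containing \<open>x\<close>; it is a
  \<open>t\<close>-prime, against uniqueness.\<close>

lemma t_Max_independent:
  assumes "PvMD R" and unique: "\<And>P. t_prime R P \<Longrightarrow> \<exists>!M. M \<in> t_Max R \<and> P \<subseteq> M"
    and M: "M \<in> t_Max R" and N: "N \<in> t_Max R" and "M \<noteq> N" and x: "x \<in> R" "x \<noteq> 0"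
  obtains s t r where "s \<in> R" "s \<notin> M" "t \<in> R" "t \<notin> N" "r \<in> R" "t * s = r * x"
proof (rule ccontr)
  assume "\<not> thesis"
  \<comment> \<open>\<open>D p\<close> expresses that \<open>1 / p\<close> has the form
    \<open>r / (t * s)\<close>, that is, \<open>p\<close> is a unit of
    \<open>R_M R_N\<close>.\<close>
  define D where "D p \<longleftrightarrow>
    (\<exists>r s t. r \<in> R \<and> s \<in> R \<and> s \<notin> M \<and> t \<in> R \<and> t \<notin> N \<and> t * s = r * p)" for p
  have DI: "D p" if "r \<in> R" "s \<in> R" "s \<notin> M" "t \<in> R" "t \<notin> N" "t * s = r * p" for p r s t
    unfolding D_def using that by (intro exI conjI)
  have DE: thesis
    if "D p" "\<And>r s t. r \<in> R \<Longrightarrow> s \<in> R \<Longrightarrow> s \<notin> M \<Longrightarrow> t \<in> R \<Longrightarrow> t \<notin> N \<Longrightarrow> t * s = r * p \<Longrightarrow> thesis"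
    for p thesis
    using that unfolding D_def by (elim exE conjE)
  have no: "\<not> D x"
    using \<open>\<not> thesis\<close> that by (auto elim!: DE)
  define P where "P = {p \<in> R. \<not> D p}"
  note DM = t_Max_D[OF M] and DN = t_Max_D[OF N]
  note pM = t_Max_prime[OF M] and pN = t_Max_prime[OF N]
  have P_sub: "P \<subseteq> R" and P_D: "p \<in> P \<Longrightarrow> \<not> D p" and PI: "p \<in> R \<Longrightarrow> \<not> D p \<Longrightarrow> p \<in> P" for p
    by (simp_all add: P_def)
  have PM: "P \<subseteq> M"
  proof
    fix p assume "p \<in> P"
    then show "p \<in> M" using DI[of 1 p 1 p] P_D[of p] P_sub DN(5) by auto
  qed
  have PN: "P \<subseteq> N"
  proof
    fix p assume "p \<in> P"
    then show "p \<in> N" using DI[of 1 1 p p] P_D[of p] P_sub DM(5) by auto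
  qed
  \<comment> \<open>Closure under addition is where the valuation property enters: if
    \<open>q\<close> divides \<open>p\<close> in \<open>R_M\<close>, it also divides
    \<open>p + q\<close>, so \<open>q\<close> would be a unit whenever \<open>p + q\<close>
    is.\<close>
  have add: "p + q \<in> P" if p: "p \<in> P" and q: "q \<in> P" and u: "u \<in> R" "u \<notin> M" "c \<in> R" "u * p = c * q"
    for p q u c
  proof (rule PI)
    show "p + q \<in> R" using p q P_sub by auto
    show "\<not> D (p + q)"
    proof
      assume "D (p + q)"
      then show False
      proof (rule DE)
        fix r s t assume r: "r \<in> R" and s: "s \<in> R" "s \<notin> M" and t: "t \<in> R" "t \<notin> N"
          and eq: "t * s = r * (p + q)"
        have "t * (u * s) = u * (r * (p + q))" using eq by (simp add: mult.left_commute)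
        also have "\<dots> = r * (u * p + u * q)" by (simp add: algebra_simps)
        also have "\<dots> = r * (c + u) * q" using u(4) by (simp add: algebra_simps)
        finally have "t * (u * s) = r * (c + u) * q" .
        moreover have "u * s \<in> R \<and> u * s \<notin> M" by (rule prime_of_compl_mult[OF pM u(1,2) s])
        moreover have "r * (c + u) \<in> R" using r u by auto
        ultimately have "D q" using t DI[of "r * (c + u)" "u * s" t q] by blast
        then show False using P_D[OF q] by simp
      qed
    qed
  qed
  have "is_submodule R P"
    unfolding is_submodule_def
  proof (intro conjI ballI)
    show "0 \<in> P"
    proof (rule PI[OF zero_R], rule notI)
      assume "D 0"
      then show False
        by (rule DE) (use submodule_zero[OF DM(3)] submodule_zero[OF DN(3)] in auto)
    qed
  next
    fix p q assume pq: "p \<in> P" "q \<in> P"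
    show "p + q \<in> P"
    proof (rule PvMD_cases[OF assms(1) M, of p q])
      fix u c assume "u \<in> R" "u \<notin> M" "c \<in> R" "u * p = c * q"
      then show "p + q \<in> P" by (rule add[OF pq])
    next
      fix u c assume "u \<in> R" "u \<notin> M" "c \<in> R" "u * q = c * p"
      then have "q + p \<in> P" by (rule add[OF pq(2,1)])
      then show "p + q \<in> P" by (simp add: add.commute)
    qed
  next
    fix a p assume a: "a \<in> R" and p: "p \<in> P"
    show "a * p \<in> P"
    proof (rule PI, use a p P_sub in blast, rule notI)
      assume "D (a * p)"
      then show False
      proof (rule DE)
        fix r s t assume "r \<in> R" "s \<in> R" "s \<notin> M" "t \<in> R" "t \<notin> N" "t * s = r * (a * p)"
        then have "D p" using DI[of "r * a" s t p] a by (auto simp: mult.assoc)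
        then show False using P_D[OF p] by simp
      qed
    qed
  qed
  moreover have "a \<in> P \<or> b \<in> P" if ab: "a \<in> R" "b \<in> R" "a * b \<in> P" for a b
  proof (rule ccontr)
    assume "\<not> (a \<in> P \<or> b \<in> P)"
    then have "D a" "D b" using PI ab(1,2) by blast+
    obtain r s t where a: "r \<in> R" "s \<in> R" "s \<notin> M" "t \<in> R" "t \<notin> N" "t * s = r * a"
      using \<open>D a\<close> by (rule DE)
    obtain r' s' t' where b: "r' \<in> R" "s' \<in> R" "s' \<notin> M" "t' \<in> R" "t' \<notin> N" "t' * s' = r' * b"
      using \<open>D b\<close> by (rule DE)
    have "(t * t') * (s * s') = (t * s) * (t' * s')" by (simp add: ac_simps)
    also have "\<dots> = (r * r') * (a * b)" unfolding a(6) b(6) by (simp add: ac_simps)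
    finally have "(t * t') * (s * s') = (r * r') * (a * b)" .
    moreover have "s * s' \<in> R \<and> s * s' \<notin> M" by (rule prime_of_compl_mult[OF pM a(2,3) b(2,3)])
    moreover have "t * t' \<in> R \<and> t * t' \<notin> N" by (rule prime_of_compl_mult[OF pN a(4,5) b(4,5)])
    moreover have "r * r' \<in> R" using a(1) b(1) by auto
    ultimately have "D (a * b)" using DI[of "r * r'" "s * s'" "t * t'" "a * b"] by blast
    then show False using P_D[OF ab(3)] by simp
  qed
  ultimately have "prime_of R P"
    unfolding prime_of_def using PM DM(5) P_sub by blast
  moreover have "x \<in> P" using no x(1) by (rule PI[rotated])
  ultimately have "t_prime R P" using prime_of_t_prime[OF assms(1) M _ PM] x(2) by blast
  then show False using unique M N PM PN \<open>M \<noteq> N\<close> by blast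
qed

subsection \<open>Integrally closed \<open>w\<close>-divisorial domains\<close>

text \<open>The integral equations obtained below from \<open>w\<close>-divisoriality all have
  degree two.\<close>

lemma integrally_closed_quadratic:
  assumes "integrally_closed R" "p \<in> R" "q \<in> R" "x * x = p * x + q"
  shows "x \<in> R"
proof -
  let ?f = "[:- q, - p, 1:]"
  have "lead_coeff ?f = 1" by simp
  moreover have "poly.coeff ?f i \<in> R" for i
    using assms(2,3) uminus_R zero_R one_R
    by (auto simp: coeff_pCons split: nat.split)
  moreover have "poly ?f x = 0"
    using assms(4) by (simp add: algebra_simps)
  ultimately show ?thesis
    using assms(1) unfolding integrally_closed_def by blast
qed

text \<open>If \<open>y\<close> and \<open>y u\<^sup>2\<close> lie in \<open>R\<close> then so does \<open>y u\<close>, because \<open>(y u)\<^sup>2 = y (y u\<^sup>2)\<close>;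
  hence \<open>u\<close> belongs to the \<open>v\<close>-closure of the ideal generated by \<open>1\<close> and \<open>u\<^sup>2\<close>.\<close>

lemma PvMD_if_w_divisorial:
  assumes ic: "integrally_closed R" and wd: "w_divisorial_domain R"
  shows "PvMD R"
  unfolding PvMD_def
proof
  fix M assume M: "M \<in> t_Max R"
  note pM = t_Max_prime[OF M] and DM = t_Max_D[OF M]
  have "(\<exists>s\<in>R. s \<notin> M \<and> s * u \<in> R) \<or> (\<exists>s\<in>R. s \<notin> M \<and> s * inverse u \<in> R)" if "u \<noteq> 0" for u
  proof -
    define I where "I = adjoin R (u * u)"
    have "1 \<in> I" "u * u \<in> I"
      using adjoinI[of 1 R 0 "u * u"] adjoinI[of 0 R 1 "u * u"] unfolding I_def by simp_all
    have nI: "nonzero_fractional_ideal R I" unfolding I_def by (rule adjoin_R_nzf)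
    note sub = nzf_submodule[OF nI]
    have "u \<in> v_closure R I"
      unfolding mem_v_closure
    proof (intro allI impI)
      fix y assume *: "\<forall>i\<in>I. y * i \<in> R"
      have y: "y \<in> R" "y * (u * u) \<in> R"
        using bspec[OF * \<open>1 \<in> I\<close>] bspec[OF * \<open>u * u \<in> I\<close>] by simp_all
      have "(u * y) * (u * y) = 0 * (u * y) + y * (y * (u * u))" by (simp add: ac_simps)
      then show "u * y \<in> R"
        by (rule integrally_closed_quadratic[OF ic zero_R mult_R[OF y]])
    qed
    then have "u \<in> w_closure R I" using v_closure_le_w[OF wd nI] by blast
    then obtain c where c: "c \<in> R" "c \<notin> M" "c * u \<in> I"
      unfolding mem_w_closure[OF sub] using M by blast
    obtain a b where ab: "a \<in> R" "b \<in> R" "c * u = a + b * (u * u)"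
      using c(3) unfolding I_def by (rule adjoinE)
    \<comment> \<open>Multiplying the relation for \<open>c * u\<close> by \<open>b\<close> makes
      \<open>b * u\<close> a root of the monic polynomial \<open>T^2 - c T + a b\<close>.\<close>
    have "(b * u) * (b * u) = b * (b * (u * u))" by (simp add: ac_simps)
    also have "b * (u * u) = c * u - a" using ab(3) by simp
    also have "b * (c * u - a) = c * (b * u) + (- (a * b))" by (simp add: algebra_simps)
    finally have bu: "b * u \<in> R"
      by (rule integrally_closed_quadratic[OF ic c(1) uminus_R[OF mult_R[OF ab(1,2)]]])
    show ?thesis
    \<comment> \<open>Outside \<open>M\<close>, \<open>b * u\<close> is a denominator of
      \<open>1 / u\<close>; inside \<open>M\<close>, the element \<open>c - b * u\<close> is outside
      \<open>M\<close> and is a denominator of \<open>u\<close>.\<close>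
    proof (cases "b * u \<in> M")
      case False
      have "(b * u) * inverse u = b" using \<open>u \<noteq> 0\<close> by simp
      then show ?thesis using ab(2) bu False by metis
    next
      case True
      have "c - b * u \<notin> M"
      proof
        assume "c - b * u \<in> M"
        then have "(c - b * u) + b * u \<in> M" using submodule_add[OF DM(3)] True by blast
        then show False using c(2) by simp
      qed
      moreover have "(c - b * u) * u = a" using ab(3) by (simp add: algebra_simps)
      moreover have "c - b * u \<in> R" using c(1) bu by (rule diff_R)
      ultimately show ?thesis using ab(1) by blast
    qed
  qed
  then show "valuation_domain (localization R M)"
    unfolding valuation_localization_iff[OF pM] by blast
qed

text \<open>The \<open>v\<close>-closure is squeezed below the \<open>w\<close>- and hence the
  \<open>t\<close>-closure, and \<open>M\<close> is a \<open>t\<close>-ideal.\<close>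

lemma t_Max_divisorial:
  assumes wd: "w_divisorial_domain R" and M: "M \<in> t_Max R"
  shows "v_closure R M = M"
proof
  note D = t_Max_D[OF M]
  show "M \<subseteq> v_closure R M" by (rule v_closure_incr)
  have "v_closure R M \<subseteq> t_closure R M"
    using v_closure_le_w[OF wd D(2)] w_closure_le_t[OF D(2)] by (rule subset_trans)
  then show "v_closure R M \<subseteq> M" using D(1) by (simp add: t_ideal_def)
qed

text \<open>For \<open>x \<in> (R : M) - R\<close> the colon \<open>(R : M)\<close> is contained in the \<open>v\<close>-closure, that is the
  \<open>w\<close>-closure, of \<open>R + x R\<close>. If \<open>M (R : M) \<subseteq> M\<close>, it contains \<open>x\<^sup>2\<close>, so \<open>x\<close> is locally integral.\<close>

lemma t_Max_witness_if_w_divisorial: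
  assumes ic: "integrally_closed R" and wd: "w_divisorial_domain R" and M: "M \<in> t_Max R"
  obtains m y where "m \<in> M" "\<forall>q\<in>M. y * q \<in> R" "m * y \<notin> M"
proof (rule ccontr)
  note DM = t_Max_D[OF M]
  assume "\<not> thesis"
  then have stable: "y * m \<in> M" if "\<forall>q\<in>M. y * q \<in> R" "m \<in> M" for y m
    using that \<open>\<And>m y. m \<in> M \<Longrightarrow> \<forall>q\<in>M. y * q \<in> R \<Longrightarrow> m * y \<notin> M \<Longrightarrow> thesis\<close>[of m y]
    by (simp add: mult.commute) blast
  \<comment> \<open>\<open>(R : M)\<close> must exceed \<open>R\<close>, since otherwise
    \<open>1\<close> would lie in the \<open>v\<close>-closure of \<open>M\<close>.\<close>
  have "1 \<notin> v_closure R M" using t_Max_divisorial[OF wd M] DM(5) by simp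
  then obtain x where x: "\<forall>q\<in>M. x * q \<in> R" "x \<notin> R"
    unfolding mem_v_closure by auto
  define I where "I = adjoin R x"
  have oneI: "1 \<in> I" and xI: "x \<in> I"
    using adjoinI[of 1 R 0 x] adjoinI[of 0 R 1 x] unfolding I_def by simp_all
  have nI: "nonzero_fractional_ideal R I" unfolding I_def by (rule adjoin_R_nzf)
  note sub = nzf_submodule[OF nI]
  define Z where "Z = colon R I"
  have Z: "z \<in> R \<and> z * x \<in> R" if "z \<in> Z" for z
    using that oneI xI unfolding Z_def colon_def by force
  have subZ: "is_submodule R Z" unfolding Z_def by (rule colon_submodule)
  have "M \<subseteq> Z"
  proof
    fix q assume q: "q \<in> M"
    have "q * (a + b * x) \<in> R" if "a \<in> R" "b \<in> R" for a b
    proof -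
      have "q * (a + b * x) = q * a + b * (x * q)" by (simp add: algebra_simps)
      then show ?thesis using q DM(4) x(1) that add_R mult_R by auto
    qed
    then show "q \<in> Z" unfolding Z_def colon_def I_def by (blast elim: adjoinE)
  qed
  \<comment> \<open>\<open>Z\<close> is divisorial and contains \<open>M\<close>. Were it larger,
    \<open>t\<close>-maximality would put \<open>1\<close> into \<open>Z\<close>, which means
    \<open>x\<close> in \<open>R\<close>.\<close>
  have ZM: "Z = M"
  proof (rule ccontr)
    assume "Z \<noteq> M"
    have ZR: "Z \<subseteq> R" using Z by blast
    have "1 \<in> t_closure R Z" by (rule t_Max_sup[OF M subZ \<open>M \<subseteq> Z\<close> ZR \<open>Z \<noteq> M\<close>])
    then have "1 \<in> v_closure R Z"
      using t_closure_le_v[OF nzf_integral_above[OF DM(2) subZ \<open>M \<subseteq> Z\<close> ZR]] by blast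
    moreover have "v_closure R Z \<subseteq> Z"
      using v_closure_least[of Z I] unfolding Z_def by simp
    ultimately show False using Z[of 1] x(2) by auto
  qed
  have "x * x \<in> v_closure R I"
    unfolding mem_v_closure
  proof (intro allI impI)
    fix y assume "\<forall>i\<in>I. y * i \<in> R"
    then have "y \<in> M" using ZM unfolding Z_def colon_def by blast
    then have "x * (x * y) \<in> R" using stable[OF x(1)] x(1) by blast
    then show "x * x * y \<in> R" by (simp add: mult.assoc)
  qed
  then have xx: "x * x \<in> w_closure R I" using v_closure_le_w[OF wd nI] by blast
  have "x \<in> R"
  proof (rule mem_R_locally)
    fix N assume "N \<in> t_Max R"
    then obtain c where c: "c \<in> R" "c \<notin> N" "c * (x * x) \<in> I"
      using xx unfolding mem_w_closure[OF sub] by blast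
    obtain a b where ab: "a \<in> R" "b \<in> R" "c * (x * x) = a + b * x"
      using c(3) unfolding I_def by (rule adjoinE)
    have "(c * x) * (c * x) = c * (c * (x * x))" by (simp add: ac_simps)
    also have "\<dots> = b * (c * x) + a * c" unfolding ab(3) by (simp add: algebra_simps)
    finally have "c * x \<in> R"
      by (rule integrally_closed_quadratic[OF ic ab(2) mult_R[OF ab(1) c(1)]])
    then show "\<exists>s\<in>R. s \<notin> N \<and> s * x \<in> R" using c by blast
  qed
  then show False using x(2) by blast
qed

text \<open>\<open>M (R : M)\<close> contains \<open>M\<close>, so by \<open>t\<close>-maximality
  its \<open>t\<close>-closure is \<open>R\<close> unless it equals \<open>M\<close>. For a witness,
  \<open>m * y\<close> is a unit of \<open>R_M\<close>, and \<open>q = m * (y * q) / (m * y)\<close>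
  for \<open>q\<close> in \<open>M\<close> shows that \<open>m\<close> generates \<open>M\<close>
  locally.\<close>

lemma t_invertible_iff_witness:
  assumes M: "M \<in> t_Max R"
  shows "t_invertible R M \<longleftrightarrow> (\<exists>m\<in>M. \<exists>y. (\<forall>q\<in>M. y * q \<in> R) \<and> m * y \<notin> M)"
proof -
  note DM = t_Max_D[OF M]
  define J where "J = ideal_mult R M (colon R M)"
  have sub: "is_submodule R J" unfolding J_def ideal_mult_def by (rule submodule_hull)
  have J_I: "m * y \<in> J" if "m \<in> M" "\<forall>q\<in>M. y * q \<in> R" for m y
    unfolding J_def ideal_mult_def using that by (intro hull_inc) (auto simp: colon_def)
  have J_least: "J \<subseteq> T" if "is_submodule R T" "\<And>m y. m \<in> M \<Longrightarrow> \<forall>q\<in>M. y * q \<in> R \<Longrightarrow> m * y \<in> T" for T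
    unfolding J_def ideal_mult_def using that by (intro hull_minimal) (auto simp: colon_def)
  have JR: "J \<subseteq> R"
    by (rule J_least[OF submodule_R]) (metis mult.commute)
  have MJ: "M \<subseteq> J"
  proof
    fix q assume "q \<in> M"
    then show "q \<in> J" using J_I[of q 1] DM(4) by auto
  qed
  have nJ: "nonzero_fractional_ideal R J" by (rule nzf_integral_above[OF DM(2) sub MJ JR])
  show ?thesis
  proof
    assume inv: "t_invertible R M"
    show "\<exists>m\<in>M. \<exists>y. (\<forall>q\<in>M. y * q \<in> R) \<and> m * y \<notin> M"
    proof (rule ccontr)
      assume "\<not> ?thesis"
      then have "J \<subseteq> M" by (intro J_least[OF DM(3)]) blast
      then have "t_closure R J \<subseteq> M"
        using t_closure_mono[OF nJ DM(2)] DM(1) by (simp add: t_ideal_def)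
      then show False using inv DM(5) one_R unfolding t_invertible_def J_def by blast
    qed
  next
    assume "\<exists>m\<in>M. \<exists>y. (\<forall>q\<in>M. y * q \<in> R) \<and> m * y \<notin> M"
    then obtain m y where "m \<in> M" "\<forall>q\<in>M. y * q \<in> R" "m * y \<notin> M" by blast
    then have "J \<noteq> M" using J_I by blast
    then have "1 \<in> t_closure R J" by (rule t_Max_sup[OF M sub MJ JR])
    then have "t_closure R J = R"
      using submodule_one_iff[OF t_closure_submodule[OF nJ] t_closure_le_R[OF nJ JR]] by simp
    then show "t_invertible R M" using DM(2) unfolding t_invertible_def J_def by simp
  qed
qed

text \<open>The ideal \<open>x R\<^sub>M \<inter> R\<close>.\<close>

definition contraction :: "'k set \<Rightarrow> 'k \<Rightarrow> 'k set" where
  "contraction M x = {z \<in> R. \<exists>s\<in>R. s \<notin> M \<and> (\<exists>r\<in>R. s * z = r * x)}"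

lemma contractionI: "z \<in> R \<Longrightarrow> s \<in> R \<Longrightarrow> s \<notin> M \<Longrightarrow> r \<in> R \<Longrightarrow> s * z = r * x \<Longrightarrow> z \<in> contraction M x"
  unfolding contraction_def by blast

lemma contractionE:
  assumes "z \<in> contraction M x"
  obtains s r where "z \<in> R" "s \<in> R" "s \<notin> M" "r \<in> R" "s * z = r * x"
  using assms unfolding contraction_def by blast

lemma contraction_submodule:
  assumes M: "M \<in> t_Max R"
  shows "is_submodule R (contraction M x)"
  unfolding is_submodule_def
proof (intro conjI ballI)
  show "0 \<in> contraction M x" using t_Max_D(5)[OF M] by (intro contractionI[of 0 1 M 0]) simp_all
next
  fix a b assume a: "a \<in> contraction M x" and b: "b \<in> contraction M x"
  obtain s r where s: "a \<in> R" "s \<in> R" "s \<notin> M" "r \<in> R" "s * a = r * x" using a by (rule contractionE)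
  obtain t q where t: "b \<in> R" "t \<in> R" "t \<notin> M" "q \<in> R" "t * b = q * x" using b by (rule contractionE)
  have "s * t * (a + b) = t * (s * a) + s * (t * b)" by (simp add: algebra_simps)
  also have "\<dots> = (t * r + s * q) * x" unfolding s(5) t(5) by (simp add: algebra_simps)
  finally have eq: "s * t * (a + b) = (t * r + s * q) * x" .
  have "s * t \<in> R \<and> s * t \<notin> M" by (rule prime_of_compl_mult[OF t_Max_prime[OF M] s(2,3) t(2,3)])
  moreover have "a + b \<in> R" "t * r + s * q \<in> R" using s t add_R mult_R by simp_all
  ultimately show "a + b \<in> contraction M x" using eq by (intro contractionI[of "a + b" "s * t" M "t * r + s * q"]) simp_all
next
  fix c a assume c: "c \<in> R" and a: "a \<in> contraction M x"
  obtain s r where s: "a \<in> R" "s \<in> R" "s \<notin> M" "r \<in> R" "s * a = r * x" using a by (rule contractionE)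
  have "s * (c * a) = c * (s * a)" by (rule mult.left_commute)
  also have "\<dots> = (c * r) * x" unfolding s(5) by (simp add: mult.assoc)
  finally show "c * a \<in> contraction M x" using s(1-4) c mult_R by (intro contractionI[of "c * a" s M "c * r"]) simp_all
qed

lemma contraction_self:
  assumes M: "M \<in> t_Max R" and "x \<in> R"
  shows "x \<in> contraction M x"
  using assms t_Max_D(5)[OF M] by (intro contractionI[of x 1 M 1]) simp_all

text \<open>The ideal is \<open>w\<close>-closed: denominators at all \<open>t\<close>-maximal
  ideals put an element of the \<open>w\<close>-closure into \<open>R\<close>, and the one at
  \<open>M\<close> is multiplied with the denominator from the contraction.\<close>

lemma contraction_divisorial:
  assumes wd: "w_divisorial_domain R" and M: "M \<in> t_Max R" and x: "x \<in> R" "x \<noteq> 0"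
  shows "v_closure R (contraction M x) = contraction M x"
proof
  let ?I = "contraction M x"
  note sub = contraction_submodule[OF M, of x]
  have IR: "?I \<subseteq> R" unfolding contraction_def by blast
  have nI: "nonzero_fractional_ideal R ?I"
    by (rule nzf_integral[OF sub IR contraction_self[OF M x(1)] x(2)])
  show "?I \<subseteq> v_closure R ?I" by (rule v_closure_incr)
  have "w_closure R ?I \<subseteq> ?I"
  proof
    fix z assume z: "z \<in> w_closure R ?I"
    have zR: "z \<in> R"
    proof (rule mem_R_locally)
      fix N assume "N \<in> t_Max R"
      then show "\<exists>s\<in>R. s \<notin> N \<and> s * z \<in> R"
        using z IR unfolding mem_w_closure[OF sub] by blast
    qed
    obtain s where s: "s \<in> R" "s \<notin> M" "s * z \<in> ?I"
      using z M unfolding mem_w_closure[OF sub] by blast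
    obtain t r where t: "t \<in> R" "t \<notin> M" "r \<in> R" "t * (s * z) = r * x"
      using s(3) by (rule contractionE)
    have "(t * s) * z = r * x" using t(4) by (simp add: mult.assoc)
    moreover have "t * s \<in> R \<and> t * s \<notin> M"
      by (rule prime_of_compl_mult[OF t_Max_prime[OF M] t(1,2) s(1,2)])
    ultimately show "z \<in> ?I" using zR t(3) by (intro contractionI[of z "t * s" M r]) simp_all
  qed
  then show "v_closure R ?I \<subseteq> ?I" using v_closure_le_w[OF wd nI] by (rule subset_trans[rotated])
qed

text \<open>With \<open>M\<close> locally generated by \<open>m\<close>, the element \<open>x y\<^sub>0\<close> generates \<open>x m\<^sup>-\<^sup>1 R\<^sub>M\<close>. It lies
  in the \<open>v\<close>-closure of \<open>x R\<^sub>M \<inter> R\<close> but not in this divisorial ideal.\<close>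

lemma t_Max_above_prime_unique:
  assumes wd: "w_divisorial_domain R" and pv: "PvMD R"
    and M: "M \<in> t_Max R" and N: "N \<in> t_Max R"
    and P: "prime_of R P" "P \<subseteq> M" "P \<subseteq> N" and x: "x \<in> P" "x \<noteq> 0"
    and m: "m \<in> M" and y0: "\<forall>q\<in>M. y0 * q \<in> R" and my0: "m * y0 \<notin> M"
  shows "M = N"
proof (rule ccontr)
  assume "M \<noteq> N"
  note DM = t_Max_D[OF M] and DN = t_Max_D[OF N] and pM = t_Max_prime[OF M] and pN = t_Max_prime[OF N]
  have xR: "x \<in> R" using x(1) prime_of_D(2)[OF P(1)] by blast
  have mR: "m \<in> R" using m DM(4) by blast
  have my0R: "m * y0 \<in> R" using bspec[OF y0 m] by (simp add: mult.commute)
  let ?I = "contraction M x"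
  have "x * y0 \<in> v_closure R ?I"
    unfolding mem_v_closure
  proof (intro allI impI)
    fix y assume y: "\<forall>i\<in>?I. y * i \<in> R"
    have e: "y * x \<in> R" using bspec[OF y contraction_self[OF M xR]] .
    show "x * y0 * y \<in> R"
    proof (rule mem_R_locally)
      fix L assume L: "L \<in> t_Max R"
      show "\<exists>s\<in>R. s \<notin> L \<and> s * (x * y0 * y) \<in> R"
      proof (cases "L = M")
        case False
        \<comment> \<open>Away from \<open>M\<close>, any element of \<open>M - L\<close> is a
          denominator of \<open>y0\<close>.\<close>
        obtain q where q: "q \<in> M" "q \<notin> L" using t_Max_incomparable[OF M L] False by blast
        have "(y * x) * (y0 * q) \<in> R" using mult_R[OF e] y0 q(1) by blast
        then have "q * (x * y0 * y) \<in> R" by (simp add: ac_simps)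
        then show ?thesis using q DM(4) by blast
      next
        case True
        show ?thesis
        proof (rule PvMD_cases[OF pv M, of "y * x" m])
          fix u r assume u: "u \<in> R" "u \<notin> M" "r \<in> R" "u * (y * x) = r * m"
          have "u * (x * y0 * y) = (u * (y * x)) * y0" by (simp add: ac_simps)
          also have "\<dots> = r * (m * y0)" unfolding u(4) by (simp add: ac_simps)
          also have "\<dots> \<in> R" using u(3) my0R by (rule mult_R)
          finally have "u * (x * y0 * y) \<in> R" .
          then show ?thesis using u(1,2) True by blast
        next
          fix u r assume u: "u \<in> R" "u \<notin> M" "r \<in> R" "u * m = r * (y * x)"
          \<comment> \<open>The case where \<open>y * x\<close> divides \<open>m\<close> in
            \<open>R_M\<close> is refuted at \<open>N\<close>. The choice of \<open>t\<close> and
            \<open>a\<close> turns this divisibility into \<open>t * m1 = a * (y * x)\<close>, with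
            \<open>m1\<close> outside \<open>N\<close>.\<close>
          obtain m1 where m1: "m1 \<in> M" "m1 \<notin> N" using t_Max_incomparable[OF M N \<open>M \<noteq> N\<close>] .
          obtain n1 where n1: "n1 \<in> N" "n1 \<notin> M" using t_Max_incomparable[OF N M] \<open>M \<noteq> N\<close> by blast
          define t where "t = (m * y0) * u"
          define a where "a = r * (y0 * m1)"
          have t: "t \<in> R" "t \<notin> M"
            using prime_of_compl_mult[OF pM my0R my0 u(1,2)] by (simp_all add: t_def)
          have a: "a \<in> R" using u(3) y0 m1(1) mult_R by (simp add: a_def)
          have "t * m1 = (u * m) * (y0 * m1)" by (simp add: t_def ac_simps)
          also have "\<dots> = a * (y * x)" unfolding u(4) by (simp add: a_def ac_simps)
          finally have tm1: "t * m1 = a * (y * x)" .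
          have n1R: "n1 \<in> R" using n1 DN(4) by blast
          have tn1: "t * n1 \<in> R" "t * n1 \<notin> M"
            using prime_of_compl_mult[OF pM t n1R n1(2)] by simp_all
          \<comment> \<open>If \<open>t * n1\<close> divides \<open>x\<close> in \<open>R_N\<close>,
            the cofactor \<open>r'\<close> lies in the contraction because \<open>t * n1\<close> is
            outside \<open>M\<close>; then \<open>y * r'\<close> is in \<open>R\<close> and
            \<open>u' * m1\<close> is forced into \<open>N\<close>. If \<open>x\<close> divides
            \<open>t * n1\<close>, then \<open>P\<close> contains \<open>u' * (t * n1)\<close> but
            neither factor.\<close>
          show ?thesis
          proof (rule PvMD_cases[OF pv N, of x "t * n1"])
            fix u' r' assume u': "u' \<in> R" "u' \<notin> N" "r' \<in> R" "u' * x = r' * (t * n1)"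
            have "r' \<in> ?I"
              using u'(1,3,4) tn1 by (intro contractionI[of r' "t * n1" M u']) (simp_all add: mult.commute)
            then have yr': "y * r' \<in> R" using y by blast
            have "t * (u' * m1) = u' * (t * m1)" by (simp add: ac_simps)
            also have "\<dots> = a * y * (u' * x)" unfolding tm1 by (simp add: ac_simps)
            also have "\<dots> = t * ((a * (y * r')) * n1)" unfolding u'(4) by (simp add: ac_simps)
            finally have "t * (u' * m1) = t * ((a * (y * r')) * n1)" .
            moreover have "t \<noteq> 0" using t(2) submodule_zero[OF DM(3)] by blast
            ultimately have "u' * m1 = (a * (y * r')) * n1" by simp
            then have "u' * m1 \<in> N" using submodule_mult[OF DN(3) mult_R[OF a yr'] n1(1)] by simp
            moreover have "m1 \<in> R" using m1(1) DM(4) by blast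
            ultimately show ?thesis using prime_of_compl_mult[OF pN u'(1,2) _ m1(2)] by blast
          next
            fix u' r' assume u': "u' \<in> R" "u' \<notin> N" "r' \<in> R" "u' * (t * n1) = r' * x"
            have "u' * (t * n1) \<in> P"
              unfolding u'(4) by (rule submodule_mult[OF prime_of_D(1)[OF P(1)] u'(3) x(1)])
            moreover have "u' \<notin> P" "t * n1 \<notin> P" using u'(2) tn1(2) P(2,3) by blast+
            ultimately show ?thesis using prime_of_compl_mult[OF P(1) u'(1) _ tn1(1)] by blast
          qed
        qed
      qed
    qed
  qed
  \<comment> \<open>Membership would make \<open>w * y0\<close> an element of \<open>R\<close> for
    some \<open>w\<close> outside \<open>M\<close>, so \<open>w * (m * y0)\<close> would lie in
    \<open>M\<close> although neither factor does.\<close>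
  then have "x * y0 \<in> ?I" using contraction_divisorial[OF wd M xR x(2)] by simp
  then obtain w r where w: "w \<in> R" "w \<notin> M" "r \<in> R" "w * (x * y0) = r * x" by (rule contractionE)
  have "x * (w * y0) = x * r" using w(4) by (simp add: ac_simps)
  then have "w * y0 = r" using x(2) by simp
  then have "(w * y0) * m \<in> M" using submodule_mult[OF DM(3) w(3) m] by simp
  then have "w * (m * y0) \<in> M" by (simp only: ac_simps)
  then show False using prime_of_compl_mult[OF pM w(1,2) my0R my0] by blast
qed

text \<open>An element of a hull involves finitely many generators. This converts a finite subset of
  a sum into a finite set of \<open>t\<close>-maximal ideals.\<close>

lemma hull_UN_finite:
  assumes "z \<in> is_submodule R hull (\<Union>i\<in>A. f i)"
  obtains F where "finite F" "F \<subseteq> A" "z \<in> is_submodule R hull (\<Union>i\<in>F. f i)"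
proof -
  define T where "T = {z. \<exists>F. finite F \<and> F \<subseteq> A \<and> z \<in> is_submodule R hull (\<Union>i\<in>F. f i)}"
  have TI: "z \<in> T" if "finite F" "F \<subseteq> A" "z \<in> is_submodule R hull (\<Union>i\<in>F. f i)" for F z
    using that unfolding T_def by blast
  have "is_submodule R T"
    unfolding is_submodule_def
  proof (intro conjI ballI)
    show "0 \<in> T" by (rule TI[of "{}"]) (simp_all add: submodule_zero submodule_hull)
  next
    fix x y assume "x \<in> T" "y \<in> T"
    then obtain F G where F: "finite F" "F \<subseteq> A" "x \<in> is_submodule R hull (\<Union>i\<in>F. f i)"
      and G: "finite G" "G \<subseteq> A" "y \<in> is_submodule R hull (\<Union>i\<in>G. f i)"
      unfolding T_def by blast
    have "x \<in> is_submodule R hull (\<Union>i\<in>F \<union> G. f i)"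
      using F(3) hull_mono[of "\<Union>i\<in>F. f i" "\<Union>i\<in>F \<union> G. f i" "is_submodule R"] by blast
    moreover have "y \<in> is_submodule R hull (\<Union>i\<in>F \<union> G. f i)"
      using G(3) hull_mono[of "\<Union>i\<in>G. f i" "\<Union>i\<in>F \<union> G. f i" "is_submodule R"] by blast
    ultimately have "x + y \<in> is_submodule R hull (\<Union>i\<in>F \<union> G. f i)"
      by (rule submodule_add[OF submodule_hull])
    then show "x + y \<in> T" by (rule TI[rotated 2]) (use F G in simp_all)
  next
    fix r x assume "r \<in> R" "x \<in> T"
    then show "r * x \<in> T" unfolding T_def using submodule_mult[OF submodule_hull] by blast
  qed
  moreover have "(\<Union>i\<in>A. f i) \<subseteq> T"
  proof
    fix z assume "z \<in> (\<Union>i\<in>A. f i)"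
    then obtain i where "i \<in> A" "z \<in> f i" by blast
    then show "z \<in> T" by (intro TI[of "{i}"]) (simp_all add: hull_inc)
  qed
  ultimately have "is_submodule R hull (\<Union>i\<in>A. f i) \<subseteq> T" by (rule hull_minimal[rotated])
  then show ?thesis using that assms unfolding T_def by blast
qed

lemma prod_not_in_prime:
  assumes P: "prime_of R P" and "finite F" and "\<And>i. i \<in> F \<Longrightarrow> s i \<in> R \<and> s i \<notin> P"
  shows "prod s F \<in> R \<and> prod s F \<notin> P"
  using assms(2,3)
proof (induction F rule: finite_induct)
  case empty
  then show ?case using prime_of_D(3)[OF P] by simp
next
  case (insert i F)
  then show ?case using prime_of_compl_mult[OF P, of "s i" "prod s F"] by simp
qed

text \<open>The ideal \<open>x R\<close> is the intersection of the ideals \<open>x R\<^sub>M \<inter> R\<close> over the \<open>t\<close>-maximal \<open>M\<close>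
  containing \<open>x\<close>. Dually, \<open>x\<^sup>-\<^sup>1\<close> lies in the \<open>v\<close>-closure of the sum of their inverses, which is a
  \<open>t\<close>-closure, so finitely many \<open>M\<close> suffice; by independence no other \<open>M\<close> contains \<open>x\<close>.\<close>

lemma finite_t_Max_containing:
  assumes wd: "w_divisorial_domain R" and pv: "PvMD R"
    and unique: "\<And>P. t_prime R P \<Longrightarrow> \<exists>!M. M \<in> t_Max R \<and> P \<subseteq> M"
    and x: "x \<in> R" "x \<noteq> 0"
  shows "finite {M \<in> t_Max R. x \<in> M}"
proof (cases "{M \<in> t_Max R. x \<in> M} = {}")
  case True
  then show ?thesis by (simp only: finite.emptyI)
next
  case False
  define A where "A = {M \<in> t_Max R. x \<in> M}"
  define J where "J = is_submodule R hull (\<Union>M\<in>A. colon R (contraction M x))"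
  have sub: "is_submodule R J" unfolding J_def by (rule submodule_hull)
  have A: "M \<in> t_Max R" "x \<in> M" if "M \<in> A" for M using that unfolding A_def by simp_all
  have colon_J: "z \<in> J" if "M \<in> A" "z \<in> colon R (contraction M x)" for M z
    unfolding J_def using that by (intro hull_inc) blast
  obtain M0 where M0: "M0 \<in> A" using False unfolding A_def by blast
  have "1 \<in> colon R (contraction M0 x)" unfolding colon_def contraction_def by simp
  then have oneJ: "1 \<in> J" by (rule colon_J[OF M0])
  have "J \<subseteq> {z. x * z \<in> R}"
    unfolding J_def
  proof (rule hull_minimal)
    show "is_submodule R {z. x * z \<in> R}"
      unfolding is_submodule_def
    proof (intro conjI ballI CollectI)
      show "x * 0 \<in> R" by simp
      fix a b assume "a \<in> {z. x * z \<in> R}" "b \<in> {z. x * z \<in> R}"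
      then show "x * (a + b) \<in> R" using add_R by (simp add: distrib_left)
    next
      fix r a assume "r \<in> R" "a \<in> {z. x * z \<in> R}"
      then have "r * (x * a) \<in> R" using mult_R by simp
      then show "x * (r * a) \<in> R" by (simp add: ac_simps)
    qed
    show "(\<Union>M\<in>A. colon R (contraction M x)) \<subseteq> {z. x * z \<in> R}"
    proof
      fix z assume "z \<in> (\<Union>M\<in>A. colon R (contraction M x))"
      then obtain M where "M \<in> A" "\<forall>i\<in>contraction M x. z * i \<in> R" unfolding colon_def by blast
      then have "z * x \<in> R" using contraction_self[OF A(1) x(1)] by blast
      then show "z \<in> {z. x * z \<in> R}" by (simp add: mult.commute)
    qed
  qed
  then have nJ: "nonzero_fractional_ideal R J"
    unfolding nzf_iff using sub x oneJ by (intro conjI bexI[of _ x] bexI[of _ 1]) auto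
  \<comment> \<open>By divisoriality a multiplier \<open>y\<close> of \<open>J\<close> into
    \<open>R\<close> lies in every contraction, so \<open>x\<close> divides it locally wherever
    \<open>x\<close> is in \<open>M\<close>; elsewhere \<open>x\<close> is a local unit.\<close>
  have "inverse x \<in> v_closure R J"
    unfolding mem_v_closure
  proof (intro allI impI)
    fix y assume y: "\<forall>i\<in>J. y * i \<in> R"
    have yR: "y \<in> R" using bspec[OF y oneJ] by simp
    have y_contr: "y \<in> contraction M x" if M: "M \<in> A" for M
    proof -
      have "y * i \<in> R" if "i \<in> colon R (contraction M x)" for i
        using bspec[OF y colon_J[OF M that]] .
      then have "y \<in> colon R (colon R (contraction M x))"
        unfolding colon_def[of R "colon R _"] by simp
      then show ?thesis
        using contraction_divisorial[OF wd A(1)[OF M] x] unfolding v_closure_def by blast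
    qed
    show "inverse x * y \<in> R"
    proof (rule mem_R_locally)
      fix M assume M: "M \<in> t_Max R"
      show "\<exists>s\<in>R. s \<notin> M \<and> s * (inverse x * y) \<in> R"
      proof (cases "x \<in> M")
        case True
        then have "M \<in> A" using M unfolding A_def by simp
        then obtain s r where s: "s \<in> R" "s \<notin> M" "r \<in> R" "s * y = r * x"
          using y_contr contractionE by metis
        have "s * (inverse x * y) = inverse x * (s * y)" by (rule mult.left_commute)
        also have "\<dots> = r" unfolding s(4) using x(2) by simp
        finally show ?thesis using s by blast
      next
        case False
        have "x * (inverse x * y) = y" using x(2) by simp
        then show ?thesis using False x(1) yR by metis
      qed
    qed
  qed
  then have "inverse x \<in> t_closure R J"
    using v_closure_le_w[OF wd nJ] w_closure_le_t[OF nJ] by blast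
  then obtain S where S: "finite S" "S \<subseteq> J" "inverse x \<in> v_closure R S"
    unfolding mem_t_closure[OF nJ] by blast
  have "\<forall>s\<in>S. \<exists>F. finite F \<and> F \<subseteq> A \<and> s \<in> is_submodule R hull (\<Union>M\<in>F. colon R (contraction M x))"
  proof
    fix s assume "s \<in> S"
    then have "s \<in> is_submodule R hull (\<Union>M\<in>A. colon R (contraction M x))" using S(2) unfolding J_def by blast
    then show "\<exists>F. finite F \<and> F \<subseteq> A \<and> s \<in> is_submodule R hull (\<Union>M\<in>F. colon R (contraction M x))"
      by (rule hull_UN_finite) blast
  qed
  then obtain F where F: "\<forall>s\<in>S. finite (F s) \<and> F s \<subseteq> A \<and>
      s \<in> is_submodule R hull (\<Union>M\<in>F s. colon R (contraction M x))"
    unfolding bchoice_iff by blast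
  define G where "G = (\<Union>s\<in>S. F s)"
  have finG: "finite G" and GA: "G \<subseteq> A" using F S(1) unfolding G_def by auto
  have S_G: "s \<in> is_submodule R hull (\<Union>M\<in>G. colon R (contraction M x))" if "s \<in> S" for s
  proof -
    have "(\<Union>M\<in>F s. colon R (contraction M x)) \<subseteq> (\<Union>M\<in>G. colon R (contraction M x))"
      using that unfolding G_def by blast
    from hull_mono[OF this] show ?thesis using F that by blast
  qed
  have "A \<subseteq> G"
  proof
    fix N assume N: "N \<in> A"
    note DN = t_Max_D[OF A(1)[OF N]] and pN = t_Max_prime[OF A(1)[OF N]]
    show "N \<in> G"
    proof (rule ccontr)
      assume "N \<notin> G"
      \<comment> \<open>Independence supplies, for each \<open>M\<close> in \<open>G\<close>, an
        element of the contraction outside \<open>N\<close>. Their product \<open>q\<close> lies in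
        all these contractions and still avoids \<open>N\<close>.\<close>
      have "\<exists>s. s \<in> R \<and> s \<notin> N \<and> s \<in> contraction M x" if M: "M \<in> G" for M
      proof -
        have MA: "M \<in> A" using M GA by blast
        have "N \<noteq> M" using M \<open>N \<notin> G\<close> by blast
        obtain s t r where "s \<in> R" "s \<notin> N" "t \<in> R" "t \<notin> M" "r \<in> R" "t * s = r * x"
          using t_Max_independent[OF pv unique A(1)[OF N] A(1)[OF MA] \<open>N \<noteq> M\<close> x] .
        then show ?thesis using contractionI[of s t M r x] by blast
      qed
      then obtain s where s: "\<And>M. M \<in> G \<Longrightarrow> s M \<in> R \<and> s M \<notin> N \<and> s M \<in> contraction M x" by metis
      define q where "q = prod s G"
      have q: "q \<in> R" "q \<notin> N" using prod_not_in_prime[OF pN finG, of s] s unfolding q_def by blast+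
      have q_contr: "q \<in> contraction M x" if M: "M \<in> G" for M
      proof -
        have "prod s (G - {M}) \<in> R"
          using prod_not_in_prime[OF pN, of "G - {M}" s] finG s by blast
        then have "prod s (G - {M}) * s M \<in> contraction M x"
          using submodule_mult[OF contraction_submodule] s[OF M] A(1) GA M by blast
        then show ?thesis unfolding q_def using prod.remove[OF finG M, of s] by (simp add: mult.commute)
      qed
      have "q \<in> colon R (\<Union>M\<in>G. colon R (contraction M x))"
      proof -
        have "q * z \<in> R" if "M \<in> G" "z \<in> colon R (contraction M x)" for M z
        proof -
          have "z * q \<in> R" using that(2) q_contr[OF that(1)] unfolding colon_def by blast
          then show ?thesis by (simp add: mult.commute)
        qed
        then show ?thesis unfolding colon_def[of R "\<Union> _"] by blast
      qed
      then have "q \<in> colon R (is_submodule R hull (\<Union>M\<in>G. colon R (contraction M x)))"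
        unfolding colon_hull .
      then have "\<forall>i\<in>S. q * i \<in> R"
        using S_G unfolding colon_def[of R "is_submodule R hull _"] by blast
      \<comment> \<open>The finite set \<open>S\<close> cannot see \<open>N\<close>:
        \<open>q\<close> multiplies it into \<open>R\<close>, which forces \<open>q\<close> into
        \<open>x R \<subseteq> N\<close>.\<close>
      then have "inverse x * q \<in> R" using S(3) unfolding mem_v_closure by blast
      then have "inverse x * q * x \<in> N" using submodule_mult[OF DN(3)] A(2)[OF N] by blast
      moreover have "inverse x * q * x = q" using x(2) by simp
      ultimately show False using q(2) by simp
    qed
  qed
  then show ?thesis using finite_subset[OF _ finG] unfolding A_def by blast
qed

lemma weakly_Matlis_PvMD_if_w_divisorial:
  assumes ic: "integrally_closed R" and wd: "w_divisorial_domain R"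
  shows "weakly_Matlis R \<and> PvMD R \<and> (\<forall>M\<in>t_Max R. t_invertible R M)"
proof -
  have pv: "PvMD R" by (rule PvMD_if_w_divisorial[OF ic wd])
  have wit: "\<exists>m\<in>M. \<exists>y. (\<forall>q\<in>M. y * q \<in> R) \<and> m * y \<notin> M" if "M \<in> t_Max R" for M
    by (rule t_Max_witness_if_w_divisorial[OF ic wd that]) blast
  have unique: "\<exists>!M. M \<in> t_Max R \<and> P \<subseteq> M" if P: "t_prime R P" for P
  proof -
    have pP: "prime_of R P" and tP: "t_ideal R P"
      using P unfolding t_prime_def primeideal_iff by simp_all
    have nP: "nonzero_fractional_ideal R P" using tP by (simp add: t_ideal_def)
    have "1 \<notin> t_closure R P" using tP prime_of_D(3)[OF pP] by (simp add: t_ideal_def)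
    then obtain M where M: "M \<in> t_Max R" "P \<subseteq> M"
      using t_Max_above[OF nP prime_of_D(2)[OF pP]] by blast
    obtain x where x: "x \<in> P" "x \<noteq> 0" using nzf_mem_R[OF nP] .
    obtain m y where my: "m \<in> M" "\<forall>q\<in>M. y * q \<in> R" "m * y \<notin> M" using wit[OF M(1)] by blast
    show ?thesis
    proof (rule ex1I[of _ M])
      show "M \<in> t_Max R \<and> P \<subseteq> M" using M by simp
      fix N assume "N \<in> t_Max R \<and> P \<subseteq> N"
      then show "N = M"
        using t_Max_above_prime_unique[OF wd pv M(1) _ pP M(2) _ x my, of N] by simp
    qed
  qed
  have "weakly_Matlis R"
    unfolding weakly_Matlis_def
    by (intro conjI ballI allI impI finite_t_Max_containing[OF wd pv] unique)
  moreover have "t_invertible R M" if "M \<in> t_Max R" for M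
    using wit[OF that] t_invertible_iff_witness[OF that] by simp
  ultimately show ?thesis using pv by blast
qed

subsection \<open>Weakly Matlis Prufer \<open>v\<close>-multiplication domains\<close>

text \<open>If \<open>x\<close> is outside \<open>V\<close>, its inverse is inside, and multiplying
  the monic equation of degree \<open>n + 1\<close> by \<open>x^(-n)\<close> expresses
  \<open>x\<close> through elements of \<open>V\<close>.\<close>

lemma valuation_domain_integrally_closed:
  fixes p :: "'k poly"
  assumes V: "valuation_domain V" and p: "lead_coeff p = 1" "\<And>i. poly.coeff p i \<in> V" "poly p x = 0"
  shows "x \<in> V"
proof (rule ccontr)
  assume "x \<notin> V"
  have sub: "subring V ring_of_type_algebra" using V by (simp add: valuation_domain_def)
  have V_mult: "a * b \<in> V" and V_add: "a + b \<in> V" if "a \<in> V" "b \<in> V" for a b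
    using subringE(6,7)[OF sub that] by (simp_all add: ring_of_type_algebra_simps)
  have V0: "0 \<in> V" and V1: "1 \<in> V"
    using subringE(2,3)[OF sub] by (simp_all add: ring_of_type_algebra_simps)
  have "x \<noteq> 0" using \<open>x \<notin> V\<close> V0 by blast
  then have inv: "inverse x \<in> V" using V \<open>x \<notin> V\<close> unfolding valuation_domain_def by blast
  have V_pow: "inverse x ^ k \<in> V" for k by (induction k) (simp_all add: V1 V_mult inv)
  have V_sum: "sum f F \<in> V" if "\<And>i. i \<in> F \<Longrightarrow> f i \<in> V" for f :: "nat \<Rightarrow> 'k" and F
    using that
  proof (induction F rule: infinite_finite_induct)
    case (insert i F)
    then have "f i \<in> V" "sum f F \<in> V" by simp_all
    then show ?case using insert.hyps V_add by simp
  qed (simp_all add: V0)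
  \<comment> \<open>The exponent is one below the degree, so that a single factor \<open>x\<close>
    survives; a monic constant has no root.\<close>
  obtain n where n: "degree p = Suc n"
  proof (cases "degree p")
    case 0
    then show ?thesis using p(1,3) by (simp add: poly_altdef)
  qed blast
  have inv_pow: "inverse x ^ k * x ^ k = 1" for k
    using \<open>x \<noteq> 0\<close> by (simp flip: power_mult_distrib)
  have cancel: "inverse x ^ n * (c * x ^ i) = c * inverse x ^ (n - i)" if "i \<le> n" for c i
  proof -
    have "inverse x ^ n = inverse x ^ (n - i) * inverse x ^ i"
      using that by (metis le_add_diff_inverse2 power_add)
    then have "inverse x ^ n * (c * x ^ i) = c * inverse x ^ (n - i) * (inverse x ^ i * x ^ i)"
      by (simp only: ac_simps)
    then show ?thesis unfolding inv_pow by simp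
  qed
  have "poly p x = (\<Sum>i\<le>n. poly.coeff p i * x ^ i) + x ^ n * x"
    using p(1) unfolding poly_altdef n by (simp add: mult.commute)
  then have "0 = inverse x ^ n * ((\<Sum>i\<le>n. poly.coeff p i * x ^ i) + x ^ n * x)"
    using p(3) by simp
  also have "\<dots> = (\<Sum>i\<le>n. inverse x ^ n * (poly.coeff p i * x ^ i)) + (inverse x ^ n * x ^ n) * x"
    unfolding distrib_left sum_distrib_left by (simp only: mult.assoc)
  also have "(\<Sum>i\<le>n. inverse x ^ n * (poly.coeff p i * x ^ i)) = (\<Sum>i\<le>n. poly.coeff p i * inverse x ^ (n - i))"
    by (intro sum.cong refl cancel) simp
  finally have "(\<Sum>i\<le>n. poly.coeff p i * inverse x ^ (n - i)) + x = 0"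
    unfolding inv_pow by simp
  then have "x = - (\<Sum>i\<le>n. poly.coeff p i * inverse x ^ (n - i))"
    using add_eq_0_iff by blast
  moreover have "(\<Sum>i\<le>n. poly.coeff p i * inverse x ^ (n - i)) \<in> V"
    by (intro V_sum V_mult p(2) V_pow)
  moreover have "- a \<in> V" if "a \<in> V" for a
    using subringE(5)[OF sub that] by (simp add: a_inv_ring_of_type_algebra)
  ultimately show False using \<open>x \<notin> V\<close> by metis
qed

text \<open>\<open>R\<close> is the intersection of the valuation rings \<open>R_M\<close>, each
  integrally closed.\<close>

lemma integrally_closed_if_PvMD:
  assumes "PvMD R"
  shows "integrally_closed R"
  unfolding integrally_closed_def
proof (intro allI impI)
  fix x and p :: "'k poly"
  assume *: "lead_coeff p = 1 \<and> (\<forall>i. poly.coeff p i \<in> R) \<and> poly p x = 0"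
  show "x \<in> R"
  proof (rule mem_R_locally)
    fix M assume M: "M \<in> t_Max R"
    note mem = mem_localization[OF submodule_zero[OF t_Max_D(3)[OF M]]]
    have "R \<subseteq> localization R M"
    proof
      fix r assume "r \<in> R"
      then show "r \<in> localization R M"
        unfolding mem using t_Max_D(5)[OF M] by (intro bexI[of _ 1]) simp_all
    qed
    then have coeffs: "poly.coeff p i \<in> localization R M" for i using * by blast
    have "valuation_domain (localization R M)" using assms M by (simp add: PvMD_def)
    then have "x \<in> localization R M"
      by (rule valuation_domain_integrally_closed[of _ p]) (simp_all only: * coeffs)
    then show "\<exists>s\<in>R. s \<notin> M \<and> s * x \<in> R" unfolding mem by simp
  qed
qed

text \<open>The point is one denominator for all of \<open>I\<close>, where the hypothesis gives one
  for each \<open>i\<close>. A nonzero \<open>e\<close> with \<open>e x I \<subseteq> R\<close> lies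
  in only finitely many \<open>t\<close>-maximal ideals; for each such \<open>N\<close> other than
  \<open>M\<close>, independence gives a factor outside \<open>M\<close> that is divisible by
  \<open>e\<close> in \<open>R_N\<close>. The product of these factors serves.\<close>

lemma colon_localization:
  assumes wm: "weakly_Matlis R" and pv: "PvMD R" and M: "M \<in> t_Max R"
    and I: "nonzero_fractional_ideal R I" and x: "\<And>i. i \<in> I \<Longrightarrow> \<exists>s\<in>R. s \<notin> M \<and> s * (x * i) \<in> R"
  obtains s where "s \<in> R" "s \<notin> M" "\<forall>i\<in>I. s * x * i \<in> R"
proof -
  have unique: "\<exists>!M. M \<in> t_Max R \<and> P \<subseteq> M" if "t_prime R P" for P
    using wm that unfolding weakly_Matlis_def by simp
  obtain d where d: "d \<in> R" "d \<noteq> 0" "\<forall>i\<in>I. d * i \<in> R" using I unfolding nzf_iff by blast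
  obtain b where b: "b \<in> R" "b \<noteq> 0" "b * x \<in> R" using denominator by blast
  define e where "e = b * d"
  have e: "e \<in> R" "e \<noteq> 0" using mult_R[OF b(1) d(1)] b(2) d(2) by (simp_all add: e_def)
  have exi: "e * (x * i) \<in> R" if "i \<in> I" for i
  proof -
    have "(b * x) * (d * i) \<in> R" using mult_R[OF b(3)] d(3) that by blast
    then show ?thesis unfolding e_def by (simp only: ac_simps)
  qed
  define F where "F = {N \<in> t_Max R. e \<in> N} - {M}"
  have "finite {N \<in> t_Max R. e \<in> N}" using wm e unfolding weakly_Matlis_def by simp
  then have finF: "finite F" unfolding F_def by simp
  have "\<forall>N\<in>F. \<exists>s. s \<in> R \<and> s \<notin> M \<and> (\<exists>t\<in>R. t \<notin> N \<and> (\<exists>r\<in>R. t * s = r * e))"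
  proof
    fix N assume "N \<in> F"
    then have N: "N \<in> t_Max R" "M \<noteq> N" unfolding F_def by blast+
    obtain s t r where "s \<in> R" "s \<notin> M" "t \<in> R" "t \<notin> N" "r \<in> R" "t * s = r * e"
      using t_Max_independent[OF pv unique M N e] .
    then show "\<exists>s. s \<in> R \<and> s \<notin> M \<and> (\<exists>t\<in>R. t \<notin> N \<and> (\<exists>r\<in>R. t * s = r * e))" by blast
  qed
  then obtain s where s: "\<forall>N\<in>F. s N \<in> R \<and> s N \<notin> M \<and> (\<exists>t\<in>R. t \<notin> N \<and> (\<exists>r\<in>R. t * s N = r * e))"
    unfolding bchoice_iff by blast
  define q where "q = prod s F"
  have q: "q \<in> R" "q \<notin> M"
    using prod_not_in_prime[OF t_Max_prime[OF M] finF, of s] s unfolding q_def by simp_all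
  have "q * x * i \<in> R" if i: "i \<in> I" for i
  proof (rule mem_R_locally)
    fix N assume N: "N \<in> t_Max R"
    consider "N = M" | "N \<in> F" | "e \<notin> N" using N unfolding F_def by blast
    then show "\<exists>u\<in>R. u \<notin> N \<and> u * (q * x * i) \<in> R"
    proof cases
      case 1
      obtain t where t: "t \<in> R" "t \<notin> M" "t * (x * i) \<in> R" using x[OF i] by blast
      have "q * (t * (x * i)) \<in> R" using q(1) t(3) by (rule mult_R)
      then have "t * (q * x * i) \<in> R" by (simp only: ac_simps)
      then show ?thesis using t(1,2) 1 by blast
    next
      case 2
      then obtain t r where t: "t \<in> R" "t \<notin> N" "r \<in> R" "t * s N = r * e" using s by blast
      define q' where "q' = prod s (F - {N})"
      have q': "q' \<in> R"
        using prod_not_in_prime[OF t_Max_prime[OF M], of "F - {N}" s] finF s unfolding q'_def by simp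
      have q_eq: "q = s N * q'" unfolding q_def q'_def by (rule prod.remove[OF finF 2])
      have "t * (q * x * i) = (t * s N) * (q' * (x * i))" unfolding q_eq by (simp only: ac_simps)
      also have "\<dots> = (r * q') * (e * (x * i))" unfolding t(4) by (simp only: ac_simps)
      also have "\<dots> \<in> R" by (intro mult_R t(3) q' exi i)
      finally show ?thesis using t(1,2) by blast
    next
      case 3
      have "q * (e * (x * i)) \<in> R" using q(1) exi[OF i] by (rule mult_R)
      then have "e * (q * x * i) \<in> R" by (simp only: ac_simps)
      then show ?thesis using 3 e(1) by blast
    qed
  qed
  then show ?thesis using that q by blast
qed

text \<open>With \<open>y\<close> a local generator of \<open>(R : M)\<close>: if \<open>z \<notin> I R\<^sub>M\<close> then \<open>I \<subseteq> z M R\<^sub>M\<close>, so \<open>y / z\<close> carries \<open>I\<close>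
  into \<open>R\<^sub>M\<close>, but it does not carry \<open>z\<close> there.\<close>

lemma v_closure_le_w_if_weakly_Matlis:
  assumes wm: "weakly_Matlis R" and pv: "PvMD R"
    and inv: "\<forall>M\<in>t_Max R. t_invertible R M" and nI: "nonzero_fractional_ideal R I"
  shows "v_closure R I \<subseteq> w_closure R I"
proof
  note I = nzf_submodule[OF nI]
  fix z assume z: "z \<in> v_closure R I"
  show "z \<in> w_closure R I"
    unfolding mem_w_closure[OF I]
  proof
    fix M assume M: "M \<in> t_Max R"
    note DM = t_Max_D[OF M] and pM = t_Max_prime[OF M]
    show "\<exists>s\<in>R. s \<notin> M \<and> s * z \<in> I"
    proof (rule ccontr)
      assume no: "\<not> ?thesis"
      have "z \<noteq> 0"
      proof
        assume "z = 0"
        then have "1 * z \<in> I" using submodule_zero[OF I] by simp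
        then show False using no DM(5) one_R by blast
      qed
      obtain m y where m: "m \<in> M" and y: "\<forall>q\<in>M. y * q \<in> R" and my: "m * y \<notin> M"
        using inv M t_invertible_iff_witness[OF M] by blast
      have "\<exists>s\<in>R. s \<notin> M \<and> s * (y / z * i) \<in> R" if i: "i \<in> I" for i
      proof (rule PvMD_cases[OF pv M, of z i])
        fix s r assume "s \<in> R" "s \<notin> M" "r \<in> R" "s * z = r * i"
        then have "s * z \<in> I" using submodule_mult[OF I _ i] by simp
        then show ?thesis using no \<open>s \<in> R\<close> \<open>s \<notin> M\<close> by blast
      next
        fix s r assume s: "s \<in> R" "s \<notin> M" "r \<in> R" "s * i = r * z"
        have "r * z \<in> I" using submodule_mult[OF I s(1) i] s(4) by simp
        then have "r \<in> M" using no s(3) by blast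
        have "s * (y / z * i) = y / z * (s * i)" by (rule mult.left_commute)
        also have "\<dots> = y * r" unfolding s(4) using \<open>z \<noteq> 0\<close> by simp
        finally have "s * (y / z * i) \<in> R" using y \<open>r \<in> M\<close> by simp
        then show ?thesis using s(1,2) by blast
      qed
      then obtain s where s: "s \<in> R" "s \<notin> M" "\<forall>i\<in>I. s * (y / z) * i \<in> R"
        using colon_localization[OF wm pv M nI, of "y / z"] by blast
      \<comment> \<open>The \<open>v\<close>-closure is used with the multiplier
        \<open>s * (y / z)\<close> of \<open>I\<close>: it sends \<open>z\<close> to
        \<open>s * y\<close>, and \<open>s * y\<close> in \<open>R\<close> would put
        \<open>s * (m * y)\<close> into \<open>M\<close>.\<close>
      have "z * (s * (y / z)) \<in> R" using z s(3) unfolding mem_v_closure by blast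
      then have "s * y \<in> R" using \<open>z \<noteq> 0\<close> by simp
      then have "s * y * m \<in> M" using submodule_mult[OF DM(3)] m by blast
      then have "s * (m * y) \<in> M" by (simp only: ac_simps)
      moreover have "m * y \<in> R" using bspec[OF y m] by (simp add: mult.commute)
      ultimately show False using prime_of_compl_mult[OF pM s(1,2) _ my] by blast
    qed
  qed
qed

lemma w_divisorial_if_weakly_Matlis_PvMD:
  assumes "weakly_Matlis R" "PvMD R" "\<forall>M\<in>t_Max R. t_invertible R M"
  shows "integrally_closed R \<and> w_divisorial_domain R"
proof
  show "integrally_closed R" by (rule integrally_closed_if_PvMD[OF assms(2)])
  show "w_divisorial_domain R"
    unfolding w_divisorial_domain_def
  proof (intro allI impI)
    fix I assume I: "w_ideal R I"
    then have nI: "nonzero_fractional_ideal R I" by (simp add: w_ideal_def)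
    then have "v_closure R I \<subseteq> I"
      using v_closure_le_w_if_weakly_Matlis[OF assms nI] I by (simp add: w_ideal_def)
    then show "divisorial R I" using nI v_closure_incr[of I] unfolding divisorial_def by blast
  qed
qed

end

lemma domain_in_fieldI:
  fixes R :: "'k::field set"
  assumes R: "subring R ring_of_type_algebra" and "has_quotient_field R"
  shows "domain_in_field R"
proof
  show "0 \<in> R" "1 \<in> R" using subringE(2,3)[OF R] by (simp_all add: ring_of_type_algebra_simps)
  show "x + y \<in> R" "x * y \<in> R" if "x \<in> R" "y \<in> R" for x y
    using subringE(6,7)[OF R that] by (simp_all add: ring_of_type_algebra_simps)
  show "- x \<in> R" if "x \<in> R" for x
    using subringE(5)[OF R that] by (simp add: a_inv_ring_of_type_algebra)
  show "\<exists>a\<in>R. \<exists>b\<in>R. b \<noteq> 0 \<and> x = a / b" for x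
    using assms(2) by (simp add: has_quotient_field_def)
qed

theorem theorem3p3:
  fixes R :: "'k::field set"
  assumes "subring R ring_of_type_algebra"
    and "has_quotient_field R"
    and "R \<noteq> UNIV"
  shows "(integrally_closed R \<and> w_divisorial_domain R) \<longleftrightarrow>
         (weakly_Matlis R \<and> PvMD R \<and> (\<forall>M\<in>t_Max R. t_invertible R M))"
proof -
  interpret domain_in_field R using assms(1,2) by (rule domain_in_fieldI)
  show ?thesis using weakly_Matlis_PvMD_if_w_divisorial w_divisorial_if_weakly_Matlis_PvMD by blast
qed

end
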